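(* Let $f:\mathbb{R}^d\to\mathbb{R}$ be $\mu$-strongly convex and $L$-smooth and consider noisy GMM on $f$ with sub-Gaussian gradient noise and with parameters $(\alpha,\beta,\gamma)=(\alpha_{\vartheta,\psi},\beta_{\vartheta,\psi},\gamma_{\vartheta,\psi})$, $(\vartheta,\psi)\in\mathcal{S}_0\cup\mathcal{S}_c$, as described in the context. Fix an arbitrary $\varphi\in(0,1)$ and a confidence level $\zeta\in(0,1)$. With $\rho^2,\lambda_P,\hat{\mathtt v},\theta_u^{sg}$ as in the context, set $\theta_\varphi^{sg}=\varphi\theta_u^{sg}$, $$\hat t^{(\varphi)}=\sqrt{(\rho^2+32\alpha^2\hat{\mathtt v}\theta_\varphi^{sg})^2+128\alpha^2\hat{\mathtt v}\theta_\varphi^{sg}},\qquad \hat{\hat\rho}^{(\varphi)}=\frac12\left(\rho^2+32\alpha^2\hat{\mathtt v}\theta_\varphi^{sg}\right)+\frac12\hat t^{(\varphi)}.$$ Consider the condition $$(\ast)\qquad\log(1/\zeta)\le128\alpha^4\hat{\mathtt v}(L+2\lambda_P)\left(\frac{\theta_\varphi^{sg}}{2-\rho^2-\hat t^{(\varphi)}-32\alpha^2\hat{\mathtt v}\theta_\varphi^{sg}}\right)^2.$$ If $(\ast)$ holds, then for every $k\ge0$ $$\mathrm{EV@R}_{1-\zeta}[f(x_k)-f(x_* )]\le\frac{\sigma^2\alpha^2}{2-\rho^2-\hat t^{(\varphi)}}\left(\sqrt{8(L+2\lambda_P)}+\sqrt{64\hat{\mathtt v}\log(1/\zeta)}\right)^2+(\hat{\hat\rho}^{(\varphi)})^k\,2\mathcal{V}_P(z_0).$$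 If $(\ast)$ does not hold, then for every $k\ge0$ $$\mathrm{EV@R}_{1-\zeta}[f(x_k)-f(x_* )]\le\frac{8\sigma^2\alpha^2(L+2\lambda_P)}{2-\rho^2-\hat t^{(\varphi)}-32\alpha^2\hat{\mathtt v}\theta_\varphi^{sg}}+\frac{2\sigma^2}{\theta_\varphi^{sg}}\log(1/\zeta)+(\hat{\hat\rho}^{(\varphi)})^k\,2\mathcal{V}_P(z_0).$$ Moreover, $$\limsup_{k\to\infty}\mathrm{EV@R}_{1-\zeta}[f(x_k)-f(x_* )]\le\begin{cases}\dfrac{\sigma^2\alpha^2}{2-\rho^2-\hat t^{(\varphi)}}\left(\sqrt{8(L+2\lambda_P)}+\sqrt{64\hat{\mathtt v}\log(1/\zeta)}\right)^2,&\text{if }(\ast)\text{ holds},\\[3mm]\dfrac{8\sigma^2\alpha^2(L+2\lambda_P)}{2-\rho^2-\hat t^{(\varphi)}-32\alpha^2\hat{\mathtt v}\theta_\varphi^{sg}}+\dfrac{2\sigma^2}{\theta_\varphi^{sg}}\log(1/\zeta),&\text{otherwise.}\end{cases}$$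
   Context: $0<\mu<L$, $\kappa=L/\mu$, $x_*$ is the unique minimizer of $f$. The noisy generalized momentum method (GMM) with parameters $(\alpha,\beta,\gamma)$ and deterministic initialization $x_0,x_{-1}\in\mathbb{R}^d$ is $$x_{k+1}=(1+\beta)x_k-\beta x_{k-1}-\alpha\left(\nabla f(y_k)+w_{k+1}\right),\qquad y_k=(1+\gamma)x_k-\gamma x_{k-1},\qquad k\ge0.$$ Sub-Gaussian noise assumption: for each $k$, $w_{k+1}$ is independent of the natural filtration $\mathcal{F}_k$ generated by $x_0,\dots,x_k$, and is centered and sub-Gaussian with variance proxy $\sigma^2>0$, i.e. $\mathbb{E}[w_{k+1}\mid\mathcal{F}_k]=0$ and $\mathbb{P}\{\|w_{k+1}\|\ge t\mid\mathcal{F}_k\}\le2e^{-t^2/(2\sigma^2)}$. Put $z_k=[x_k^\top,x_{k-1}^\top]^\top$, $z_*=[x_*^\top,x_*^\top]^\top$. Parameter choice. Let $\mathcal{S}_0=\{(1,1)\}$, $\mathcal{S}_+=\{(\vartheta,\psi)\mid\psi>1,\ 1<\vartheta\le2-\frac1\psi\}$, $\mathcal{S}_-=\{(\vartheta,\psi)\mid0\le\psi<1,\ \max\{2-\frac1\psi,\frac1{1+\kappa(1-\psi)}\}\le\vartheta<1\}$ (for $\psi=0$ the maximum is read as $\frac1{1+\kappa}$), $$\mathcal{S}_1=\left\{(\vartheta,\psi)\;\middle|\;\psi\ne1,\ \left[1-\sqrt{\tfrac{(1-\vartheta)\vartheta}{\kappa(1-\psi)}}\right]\left[1-\tfrac{(1-\vartheta)(\mu\psi^2-L(1-\psi)^2)}{L(1-\psi)\vartheta}\right]\le\left[1-\tfrac{(1-\vartheta)\psi}{\kappa(1-\psi)}\right]^2\right\},$$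 $\mathcal{S}_c=(\mathcal{S}_-\cup\mathcal{S}_+)\cap\mathcal{S}_1$. For $(\vartheta,\psi)\in\mathcal{S}_0\cup\mathcal{S}_c$: $\alpha_{\vartheta,\psi}=\frac{1-\vartheta}{L(1-\psi)}$ if $(\vartheta,\psi)\in\mathcal{S}_c$, $\alpha_{\vartheta,\psi}$ is any number in $(0,\frac1L]$ if $(\vartheta,\psi)\in\mathcal{S}_0$; $\beta_{\vartheta,\psi}=\frac{1-\sqrt{\vartheta\alpha_{\vartheta,\psi}\mu}}{1-\alpha_{\vartheta,\psi}\psi\mu}\left[1-\sqrt{\frac{\alpha_{\vartheta,\psi}\mu}{\vartheta}}\right]$; $\gamma_{\vartheta,\psi}=\psi\beta_{\vartheta,\psi}$. With these $\alpha,\beta,\gamma$: $\rho^2=1-\sqrt{\vartheta\alpha\mu}$, $\lambda_P=\frac{\vartheta}{2\alpha}$, $$\hat{\mathtt v}=\frac{2L^2}{\mu}\left(2(\beta-\gamma)^2+(1-\alpha L)^2(1+2\gamma+2\gamma^2)\right)+\lambda_P\rho^2,\qquad \theta_u^{sg}=\min\left\{\frac{1-\rho^2}{64\alpha^2\hat{\mathtt v}},\ \frac1{4\alpha^2(L+2\lambda_P)}\right\}.$$ Lyapunov function: $\mathcal{V}_P(z_k)=(z_k-z_* )^\top P(z_k-z_* )+f(x_k)-f(x_* )$ with $P=(\tilde p\tilde p^\top)\otimes I_d$, $\tilde p=\left[\sqrt{\frac{\vartheta}{2\alpha}},\ -\sqrt{\frac{\vartheta}{2\alpha}}+\sqrt{\frac\mu2}\right]^\top$.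 Entropic value at risk: with $r_{k,\sigma^2}(\theta)=\frac{2\sigma^2}{\theta}\log\mathbb{E}\left[e^{\frac{\theta}{2\sigma^2}(f(x_k)-f(x_* ))}\right]$ (possibly $+\infty$), $\mathrm{EV@R}_{1-\zeta}[f(x_k)-f(x_* )]=\inf_{\theta>0}\left\{r_{k,\sigma^2}(\theta)+\frac{2\sigma^2}{\theta}\log\frac1\zeta\right\}$. *)

theory Defs
  imports "HOL-Probability.Probability"
begin

section \<open>Strongly convex and smooth functions\<close>

definition grad :: "(real ^ 'd \<Rightarrow> real) \<Rightarrow> real ^ 'd \<Rightarrow> real ^ 'd" where
  "grad f x = (THE g. GDERIV f x :> g)"

definition strongly_convex :: "real \<Rightarrow> (real ^ 'd \<Rightarrow> real) \<Rightarrow> bool" where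
  "strongly_convex \<mu> f \<longleftrightarrow> convex_on UNIV (\<lambda>x. f x - \<mu> / 2 * (norm x)\<^sup>2)"

definition smooth :: "real \<Rightarrow> (real ^ 'd \<Rightarrow> real) \<Rightarrow> bool" where
  "smooth L f \<longleftrightarrow> (\<forall>x. f differentiable (at x)) \<and> L-lipschitz_on UNIV (grad f)"


section \<open>The generalized momentum method\<close>

text \<open>
  The state after \<open>k\<close> steps is the pair of \<open>x\<^sub>k\<close> and \<open>x\<^sub>k\<^sub>-\<^sub>1\<close>; the argument \<open>xm\<close> is
  \<open>x\<^sub>-\<^sub>1\<close>. The value \<open>w 0\<close> of the noise sequence is never used.
\<close>

primrec gmm_state ::
  "(real ^ 'd \<Rightarrow> real) \<Rightarrow> real \<Rightarrow> real \<Rightarrow> real \<Rightarrow> real ^ 'd \<Rightarrow> real ^ 'd \<Rightarrow>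
   (nat \<Rightarrow> real ^ 'd) \<Rightarrow> nat \<Rightarrow> (real ^ 'd) \<times> (real ^ 'd)" where
  "gmm_state f \<alpha> \<beta> \<gamma> x0 xm w 0 = (x0, xm)"
| "gmm_state f \<alpha> \<beta> \<gamma> x0 xm w (Suc k) =
    (let (x, x') = gmm_state f \<alpha> \<beta> \<gamma> x0 xm w k;
         y = (1 + \<gamma>) *\<^sub>R x - \<gamma> *\<^sub>R x'
     in ((1 + \<beta>) *\<^sub>R x - \<beta> *\<^sub>R x' - \<alpha> *\<^sub>R (grad f y + w (Suc k)), x))"

definition gmm_iterate ::
  "(real ^ 'd \<Rightarrow> real) \<Rightarrow> real \<Rightarrow> real \<Rightarrow> real \<Rightarrow> real ^ 'd \<Rightarrow> real ^ 'd \<Rightarrow>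
   (nat \<Rightarrow> 'a \<Rightarrow> real ^ 'd) \<Rightarrow> nat \<Rightarrow> 'a \<Rightarrow> real ^ 'd" where
  "gmm_iterate f \<alpha> \<beta> \<gamma> x0 xm w k \<omega> = fst (gmm_state f \<alpha> \<beta> \<gamma> x0 xm (\<lambda>j. w j \<omega>) k)"


section \<open>Sub-Gaussian noise\<close>

definition natural_filtration ::
  "'a measure \<Rightarrow> (nat \<Rightarrow> 'a \<Rightarrow> 'b::topological_space) \<Rightarrow> nat \<Rightarrow> 'a measure" where
  "natural_filtration M x k =
    sigma (space M) {x i -` A \<inter> space M | i A. i \<le> k \<and> A \<in> sets borel}"

text \<open>
  The conditional expectation of a vector is taken componentwise, and the conditional
  probability of an event is the conditional expectation of its indicator. The tail bound
  is required for \<open>t \<ge> 0\<close> only: for negative \<open>t\<close> the event is the whole space.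
\<close>

definition subgaussian_noise ::
  "'a measure \<Rightarrow> (nat \<Rightarrow> 'a measure) \<Rightarrow> real \<Rightarrow> (nat \<Rightarrow> 'a \<Rightarrow> real ^ 'd) \<Rightarrow> bool" where
  "subgaussian_noise M F \<sigma> w \<longleftrightarrow>
    (\<forall>k. w (Suc k) \<in> borel_measurable M \<and>
         prob_space.indep_set M
           (sets (vimage_algebra (space M) (w (Suc k)) borel)) (sets (F k)) \<and>
         integrable M (w (Suc k)) \<and>
         (\<forall>i. AE \<omega> in M. real_cond_exp M (F k) (\<lambda>\<omega>. w (Suc k) \<omega> $ i) \<omega> = 0) \<and>
         (\<forall>t\<ge>0. AE \<omega> in M.
            real_cond_exp M (F k) (indicator {\<omega> \<in> space M. norm (w (Suc k) \<omega>) \<ge> t}) \<omega>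
              \<le> 2 * exp (- t\<^sup>2 / (2 * \<sigma>\<^sup>2))))"


section \<open>Admissible parameters\<close>

definition S_zero :: "(real \<times> real) set" where
  "S_zero = {(1, 1)}"

definition S_plus :: "(real \<times> real) set" where
  "S_plus = {(\<theta>, \<psi>). \<psi> > 1 \<and> 1 < \<theta> \<and> \<theta> \<le> 2 - 1 / \<psi>}"

definition S_minus :: "real \<Rightarrow> (real \<times> real) set" where
  "S_minus \<kappa> = {(\<theta>, \<psi>). 0 \<le> \<psi> \<and> \<psi> < 1 \<and>
     (if \<psi> = 0 then 1 / (1 + \<kappa>) else max (2 - 1 / \<psi>) (1 / (1 + \<kappa> * (1 - \<psi>)))) \<le> \<theta> \<and>
     \<theta> < 1}"

text \<open>
  On \<open>S_minus (L / \<mu>) \<union> S_plus\<close>, with \<open>0 < \<mu> < L\<close>, the argument of the square root below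
  is positive and no denominator vanishes; elsewhere \<open>S_one\<close> is not used.
\<close>

definition S_one :: "real \<Rightarrow> real \<Rightarrow> (real \<times> real) set" where
  "S_one \<mu> L = {(\<theta>, \<psi>). \<psi> \<noteq> 1 \<and>
     (1 - sqrt ((1 - \<theta>) * \<theta> / (L / \<mu> * (1 - \<psi>)))) *
     (1 - (1 - \<theta>) * (\<mu> * \<psi>\<^sup>2 - L * (1 - \<psi>)\<^sup>2) / (L * (1 - \<psi>) * \<theta>))
       \<le> (1 - (1 - \<theta>) * \<psi> / (L / \<mu> * (1 - \<psi>)))\<^sup>2}"

definition S_c :: "real \<Rightarrow> real \<Rightarrow> (real \<times> real) set" where
  "S_c \<mu> L = (S_minus (L / \<mu>) \<union> S_plus) \<inter> S_one \<mu> L"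


section \<open>The Lyapunov function\<close>

definition kronecker ::
  "real ^ 'n ^ 'm \<Rightarrow> real ^ 'q ^ 'p \<Rightarrow>
   real ^ ('n::finite \<times> 'q::finite) ^ ('m::finite \<times> 'p::finite)" where
  "kronecker A B = (\<chi> i j. A $ fst i $ fst j * B $ snd i $ snd j)"

definition stack :: "real ^ 'd \<Rightarrow> real ^ 'd \<Rightarrow> real ^ (2 \<times> 'd::finite)" where
  "stack x x' = (\<chi> i. if fst i = 1 then x $ snd i else x' $ snd i)"

definition gmm_p :: "real \<Rightarrow> real \<Rightarrow> real \<Rightarrow> real ^ 2" where
  "gmm_p \<mu> \<theta> \<alpha> = vector [sqrt (\<theta> / (2 * \<alpha>)), - sqrt (\<theta> / (2 * \<alpha>)) + sqrt (\<mu> / 2)]"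

definition gmm_P :: "real \<Rightarrow> real \<Rightarrow> real \<Rightarrow> real ^ (2 \<times> 'd::finite) ^ (2 \<times> 'd::finite)" where
  "gmm_P \<mu> \<theta> \<alpha> =
    kronecker (\<chi> i j. gmm_p \<mu> \<theta> \<alpha> $ i * gmm_p \<mu> \<theta> \<alpha> $ j) (mat 1 :: real ^ 'd ^ 'd)"

definition lyapunov ::
  "(real ^ 'd \<Rightarrow> real) \<Rightarrow> real ^ 'd \<Rightarrow> real ^ (2 \<times> 'd::finite) ^ (2 \<times> 'd::finite) \<Rightarrow>
   real ^ 'd \<Rightarrow> real ^ 'd \<Rightarrow> real" where
  "lyapunov f xs P x x' =
    (stack x x' - stack xs xs) \<bullet> (P *v (stack x x' - stack xs xs)) + f x - f xs"


section \<open>Entropic risk and entropic value at risk\<close>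

definition entropic_risk :: "'a measure \<Rightarrow> real \<Rightarrow> ('a \<Rightarrow> real) \<Rightarrow> real \<Rightarrow> ereal" where
  "entropic_risk M \<sigma> X \<theta> =
    (if integrable M (\<lambda>\<omega>. exp (\<theta> / (2 * \<sigma>\<^sup>2) * X \<omega>))
     then ereal (2 * \<sigma>\<^sup>2 / \<theta> * ln (\<integral>\<omega>. exp (\<theta> / (2 * \<sigma>\<^sup>2) * X \<omega>) \<partial>M))
     else \<infinity>)"

text \<open>
  \<open>EVaR M \<sigma> \<zeta> X\<close> is the entropic value at risk of \<open>X\<close> at level \<open>1 - \<zeta>\<close>.
\<close>

definition EVaR :: "'a measure \<Rightarrow> real \<Rightarrow> real \<Rightarrow> ('a \<Rightarrow> real) \<Rightarrow> ereal" where
  "EVaR M \<sigma> \<zeta> X =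
    (INF \<theta>\<in>{0<..}. entropic_risk M \<sigma> X \<theta> + ereal (2 * \<sigma>\<^sup>2 / \<theta> * ln (1 / \<zeta>)))"

end

theory Submission
  imports Defs
begin

text \<open>
  The iteration contracts the Lyapunov function when there is no noise, and the noise is light
  enough for this contraction to survive in exponential moments.

  \<^item> Without noise, one step multiplies the Lyapunov function by at most \<open>\<rho>\<^sup>2\<close>
    (\<open>lyapunov_contraction\<close>). Smoothness and strong convexity reduce this to a quadratic form in
    position, velocity and gradient, and the parameters are tuned to annihilate all its mixed
    coefficients; the inequality that defines \<^const>\<open>S_one\<close> is the sign of the velocity coefficient.

  \<^item> The noise \<open>w\<close> changes the Lyapunov function by \<open>- \<alpha> G \<bullet> w\<close> plus at most
    \<open>\<alpha>\<^sup>2 (L + 2 \<lambda>\<^sub>P) |w|\<^sup>2 / 2\<close>, where \<open>G\<close> depends only on the past and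
    \<open>|G|\<^sup>2 \<le> (2 L + 4 \<lambda>\<^sub>P) \<rho>\<^sup>2 V\<close> (\<open>lyapunov_noise_expansion\<close>, \<open>noise_direction_bound\<close>). Admissible
    parameters satisfy \<open>\<alpha> L \<le> 3 \<theta>\<close>, that is \<open>L \<le> 6 \<lambda>\<^sub>P\<close> (\<open>step_le_three_theta\<close>), so
    \<open>|G|\<^sup>2 \<le> 16 \<lambda>\<^sub>P \<rho>\<^sup>2 V \<le> 16 v_hat V\<close>.

  \<^item> For sub-Gaussian centered noise \<open>W\<close>,
    \<open>E exp (v \<bullet> W + \<eta> |W|\<^sup>2) \<le> exp (8 \<sigma>\<^sup>2 \<eta> + 4 \<sigma>\<^sup>2 |v|\<^sup>2)\<close> as long as \<open>16 \<eta> \<sigma>\<^sup>2 \<le> 1\<close>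
    (\<open>subgaussian_mgf\<close>). Given the past, one step therefore turns the exponential moment of \<open>c V\<close>
    into that of \<open>c A V\<close> at the price of a constant factor, with \<open>A = \<rho>\<^sup>2 + 32 \<alpha>\<^sup>2 v_hat t\<close> for the
    risk parameter \<open>t = 2 \<sigma>\<^sup>2 c\<close>. Iterating yields a geometric series
    (\<open>lyapunov_exp_moment\<close>), so the entropic risk at \<open>t\<close> is at most
    \<open>4 \<sigma>\<^sup>2 \<alpha>\<^sup>2 (L + 2 \<lambda>\<^sub>P) / (1 - A) + A^k V\<close>, with the Lyapunov function at the start.

  \<^item> Since \<open>A \<le> rho_hat < 1\<close>, this is at most the bound of the theorem as a function of \<open>t\<close>. The
    value at risk is an infimum over \<open>t\<close>, and the bound is minimised over \<open>0 < t \<le> theta_phi\<close>. The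
    condition \<open>star\<close> says that the unconstrained minimiser lies in this interval
    (\<open>risk_bound_minimiser\<close>); otherwise \<open>t = theta_phi\<close> is used. The bound on the upper limit follows
    because \<open>rho_hat^k\<close> tends to \<open>0\<close>.
\<close>


section \<open>Smooth and strongly convex functions\<close>

lemma GDERIV_grad:
  fixes f :: "real ^ 'd \<Rightarrow> real"
  assumes "f differentiable (at x)"
  shows "GDERIV f x :> grad f x"
proof -
  obtain f' where f': "(f has_derivative f') (at x)"
    using assms by (auto simp: differentiable_def)
  then have lin: "linear f'"
    by (simp add: has_derivative_linear)
  define g where "g = (\<Sum>i\<in>Basis. f' i *\<^sub>R i)"
  have "f' h = h \<bullet> g" for h
  proof -
    have "f' h = f' (\<Sum>i\<in>Basis. (h \<bullet> i) *\<^sub>R i)"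
      by (simp add: euclidean_representation)
    also have "\<dots> = (\<Sum>i\<in>Basis. (h \<bullet> i) * f' i)"
      by (simp add: linear_sum[OF lin] linear_scale[OF lin])
    also have "\<dots> = h \<bullet> g"
      by (simp add: g_def inner_sum_right mult.commute)
    finally show ?thesis .
  qed
  then have "f' = (\<lambda>h. h \<bullet> g)"
    by (rule ext)
  with f' have "GDERIV f x :> g"
    by (simp add: gderiv_def)
  moreover have "g' = g" if "GDERIV f x :> g'" for g'
  proof -
    have "(\<lambda>h. h \<bullet> g') = (\<lambda>h. h \<bullet> g)"
      using that \<open>GDERIV f x :> g\<close> unfolding gderiv_def by (rule has_derivative_unique)
    then show ?thesis
      unfolding fun_eq_iff by (rule vector_eq_ldot[THEN iffD1])
  qed
  ultimately show ?thesis
    unfolding grad_def by (rule theI)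
qed

lemma has_real_derivative_along_line:
  fixes f :: "real ^ 'd \<Rightarrow> real"
  assumes "f differentiable (at (x + t *\<^sub>R d))"
  shows "((\<lambda>s. f (x + s *\<^sub>R d)) has_real_derivative d \<bullet> grad f (x + t *\<^sub>R d)) (at t)"
proof -
  have "((\<lambda>s. x + s *\<^sub>R d) has_derivative (\<lambda>s. s *\<^sub>R d)) (at t)"
    by (auto intro!: derivative_eq_intros)
  moreover have "(f has_derivative (\<lambda>h. h \<bullet> grad f (x + t *\<^sub>R d))) (at (x + t *\<^sub>R d))"
    using GDERIV_grad[OF assms] by (simp add: gderiv_def)
  ultimately have "((\<lambda>s. f (x + s *\<^sub>R d)) has_derivative (\<lambda>s. (s *\<^sub>R d) \<bullet> grad f (x + t *\<^sub>R d))) (at t)"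
    by (rule has_derivative_compose)
  moreover have "(\<lambda>s. (s *\<^sub>R d) \<bullet> grad f (x + t *\<^sub>R d)) = (*) (d \<bullet> grad f (x + t *\<^sub>R d))"
    by auto
  ultimately show ?thesis
    by (simp add: has_field_derivative_def)
qed

text \<open>
  The tangent inequality of the convex function \<open>f - \<mu>/2 |.|\<^sup>2\<close>, restricted to the line through \<open>x\<close>
  and \<open>y\<close> so that the one-dimensional result applies.
\<close>

lemma strongly_convex_tangent:
  fixes f :: "real ^ 'd \<Rightarrow> real"
  assumes "strongly_convex \<mu> f" "f differentiable (at x)"
  shows "f x + grad f x \<bullet> (y - x) + \<mu> / 2 * (norm (y - x))\<^sup>2 \<le> f y"
proof -
  define h where "h x = f x - \<mu> / 2 * (norm x)\<^sup>2" for x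
  define d where "d = y - x"
  have "convex_on UNIV h"
    using assms(1) by (simp add: strongly_convex_def h_def[abs_def])
  have conv: "convex_on UNIV (\<lambda>s. h (x + s *\<^sub>R d))"
  proof (rule convex_onI)
    fix t a b :: real assume t: "0 < t" "t < 1"
    have "x + ((1 - t) * a + t * b) *\<^sub>R d = (1 - t) *\<^sub>R (x + a *\<^sub>R d) + t *\<^sub>R (x + b *\<^sub>R d)"
      by (simp add: algebra_simps)
    then show "h (x + ((1 - t) *\<^sub>R a + t *\<^sub>R b) *\<^sub>R d)
        \<le> (1 - t) * h (x + a *\<^sub>R d) + t * h (x + b *\<^sub>R d)"
      using convex_onD[OF \<open>convex_on UNIV h\<close>, of t "x + a *\<^sub>R d" "x + b *\<^sub>R d"] t by simp
  qed simp
  have nrm: "(norm (x + s *\<^sub>R d))\<^sup>2 = (norm x)\<^sup>2 + 2 * s * (x \<bullet> d) + s\<^sup>2 * (norm d)\<^sup>2" for s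
    unfolding power2_norm_eq_inner
    by (simp add: inner_add_left inner_add_right inner_commute power2_eq_square)
  have der: "((\<lambda>s. h (x + s *\<^sub>R d)) has_real_derivative d \<bullet> grad f x - \<mu> * (x \<bullet> d)) (at 0)"
    unfolding h_def nrm
    by (rule derivative_eq_intros has_real_derivative_along_line | use assms(2) in simp)+
  have "h (x + 1 *\<^sub>R d) - h (x + 0 *\<^sub>R d) \<ge> (d \<bullet> grad f x - \<mu> * (x \<bullet> d)) * (1 - 0)"
    by (rule convex_on_imp_above_tangent[OF conv]) (use der in auto)
  moreover have "h (x + 1 *\<^sub>R d) = f y - \<mu> / 2 * ((norm x)\<^sup>2 + 2 * (x \<bullet> d) + (norm d)\<^sup>2)"
    using nrm[of 1] by (simp add: h_def d_def)
  ultimately show ?thesis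
    by (simp add: h_def algebra_simps inner_commute flip: d_def)
qed

text \<open>
  Along the segment from \<open>x\<close> to \<open>y\<close> the difference of the two sides has a derivative of constant
  sign, because the gradient can turn by at most \<open>L\<close> times the distance travelled.
\<close>

lemma smooth_descent:
  fixes f :: "real ^ 'd \<Rightarrow> real"
  assumes "smooth L f"
  shows "f y \<le> f x + grad f x \<bullet> (y - x) + L / 2 * (norm (y - x))\<^sup>2"
proof -
  define d where "d = y - x"
  have diff: "f differentiable (at z)" for z
    using assms by (simp add: smooth_def)
  define h where "h t = f (x + t *\<^sub>R d) - t * (grad f x \<bullet> d) - L / 2 * t\<^sup>2 * (norm d)\<^sup>2" for t
  have "h 1 \<le> h 0"
  proof (rule DERIV_nonpos_imp_nonincreasing[of 0 1 h])
    fix t :: real assume t: "0 \<le> t" "t \<le> 1"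
    let ?h' = "d \<bullet> grad f (x + t *\<^sub>R d) - grad f x \<bullet> d - L * t * (norm d)\<^sup>2"
    have "(h has_real_derivative ?h') (at t)"
      unfolding h_def by (rule derivative_eq_intros has_real_derivative_along_line[OF diff] refl | simp)+
    moreover have "?h' \<le> 0"
    proof -
      have "d \<bullet> grad f (x + t *\<^sub>R d) - grad f x \<bullet> d = (grad f (x + t *\<^sub>R d) - grad f x) \<bullet> d"
        by (simp add: inner_diff_left inner_diff_right inner_commute)
      also have "\<dots> \<le> norm (grad f (x + t *\<^sub>R d) - grad f x) * norm d"
        by (rule norm_cauchy_schwarz)
      also have "\<dots> \<le> (L * norm (t *\<^sub>R d)) * norm d"
      proof (rule mult_right_mono)
        show "norm (grad f (x + t *\<^sub>R d) - grad f x) \<le> L * norm (t *\<^sub>R d)"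
          using lipschitz_onD[of L UNIV "grad f" "x + t *\<^sub>R d" x] assms
          by (simp add: smooth_def dist_norm)
      qed simp
      finally show ?thesis
        using t by (simp add: power2_eq_square mult.assoc)
    qed
    ultimately show "\<exists>h'. (h has_real_derivative h') (at t) \<and> h' \<le> 0"
      by blast
  qed simp
  then show ?thesis
    by (simp add: h_def d_def algebra_simps)
qed

text \<open>
  One gradient step of length \<open>1/L\<close> lowers \<open>f\<close> by at least \<open>|grad f x|\<^sup>2 / (2 L)\<close>, and it cannot go
  below the minimum.
\<close>

lemma norm_grad_le_gap:
  fixes f :: "real ^ 'd \<Rightarrow> real"
  assumes "smooth L f" "0 < L" "\<And>y. f xs \<le> f y"
  shows "(norm (grad f x))\<^sup>2 \<le> 2 * L * (f x - f xs)"
proof -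
  have "f xs \<le> f (x - (1 / L) *\<^sub>R grad f x)"
    by (rule assms(3))
  also have "\<dots> \<le> f x - (norm (grad f x))\<^sup>2 / (2 * L)"
    using smooth_descent[OF assms(1), of "x - (1 / L) *\<^sub>R grad f x" x] \<open>0 < L\<close>
    by (simp add: power_divide field_simps power2_eq_square flip: power2_norm_eq_inner)
  finally show ?thesis
    using \<open>0 < L\<close> by (simp add: field_simps)
qed

lemma continuous_grad:
  assumes "smooth L f"
  shows "continuous_on UNIV (grad f)"
  using assms by (auto simp: smooth_def intro: lipschitz_on_continuous_on)

section \<open>Contraction of the Lyapunov function\<close>

text \<open>
  The matrix \<open>P\<close> has rank one up to the Kronecker factor, so its quadratic form is the square of
  the norm of a single vector, a combination of the last two deviations from the minimizer.
\<close>

definition lyapunov_vec :: "real \<Rightarrow> real \<Rightarrow> real \<Rightarrow> 'b::real_vector \<Rightarrow> 'b \<Rightarrow> 'b" where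
  "lyapunov_vec \<mu> \<theta> \<alpha> u u' =
     sqrt (\<theta> / (2 * \<alpha>)) *\<^sub>R u + (sqrt (\<mu> / 2) - sqrt (\<theta> / (2 * \<alpha>))) *\<^sub>R u'"

lemma lyapunov_eq:
  fixes f :: "real ^ 'd \<Rightarrow> real"
  shows "lyapunov f xs (gmm_P \<mu> \<theta> \<alpha>) x x'
    = (norm (lyapunov_vec \<mu> \<theta> \<alpha> (x - xs) (x' - xs)))\<^sup>2 + f x - f xs"
proof -
  define u u' where "u = x - xs" and "u' = x' - xs"
  define p q where "p = sqrt (\<theta> / (2 * \<alpha>))" and "q = sqrt (\<mu> / 2) - p"
  have st: "stack x x' - stack xs xs = stack u u'"
    by (simp add: stack_def vec_eq_iff u_def u'_def)
  have sum_pairs: "(\<Sum>i\<in>UNIV. h i) = (\<Sum>m\<in>UNIV. h (1, m) + h (2, m))"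
    for h :: "2 \<times> 'd \<Rightarrow> real"
    by (simp add: UNIV_Times_UNIV[symmetric] sum.cartesian_product' sum_2 sum.distrib
        del: UNIV_Times_UNIV)
  have stack_simps: "stack u u' $ (1, m) = u $ m" "stack u u' $ (2, m) = u' $ m" for m
    by (simp_all add: stack_def)
  have p_simps: "gmm_p \<mu> \<theta> \<alpha> $ 1 = p" "gmm_p \<mu> \<theta> \<alpha> $ 2 = q"
    by (simp_all add: gmm_p_def p_def q_def)
  have P: "(gmm_P \<mu> \<theta> \<alpha> *v stack u u') $ (a, n)
      = gmm_p \<mu> \<theta> \<alpha> $ a * (p * u $ n + q * u' $ n)" for a :: 2 and n :: 'd
  proof -
    have "(gmm_P \<mu> \<theta> \<alpha> *v stack u u') $ (a, n) = (\<Sum>m\<in>UNIV.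
        if m = n then gmm_p \<mu> \<theta> \<alpha> $ a * (p * u $ m + q * u' $ m) else 0)"
      unfolding matrix_vector_mult_def gmm_P_def kronecker_def mat_def vec_lambda_beta sum_pairs
        fst_conv snd_conv stack_simps p_simps
      by (intro sum.cong refl) (simp add: algebra_simps)
    then show ?thesis
      by simp
  qed
  have "stack u u' \<bullet> (gmm_P \<mu> \<theta> \<alpha> *v stack u u') = (\<Sum>m\<in>UNIV. (p * u $ m + q * u' $ m)\<^sup>2)"
    by (auto simp: inner_vec_def sum_pairs P stack_simps p_simps
        algebra_simps power2_eq_square intro!: sum.cong)
  also have "\<dots> = (norm (lyapunov_vec \<mu> \<theta> \<alpha> u u'))\<^sup>2"
    unfolding power2_norm_eq_inner lyapunov_vec_def p_def[symmetric] q_def[symmetric]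
    by (simp add: inner_vec_def power2_eq_square)
  finally show ?thesis
    by (simp add: lyapunov_def st u_def u'_def)
qed

text \<open>
  The consequences of the admissibility of \<open>(\<theta>, \<psi>)\<close> that the analysis runs on. In all of the
  admissible regions the step size satisfies \<open>1 - \<theta> = \<alpha> L (1 - \<psi>)\<close>; this single relation makes the
  gradient decouple from the other variables in the contraction proof. \<open>rate_condition\<close> is the
  inequality of \<^const>\<open>S_one\<close> with denominators cleared, and \<open>step_le\<close> is what allows the noise to be
  absorbed by the term \<open>\<lambda>\<^sub>P \<rho>\<^sup>2\<close> of the constant \<open>v_hat\<close>.
\<close>

locale gmm_parameters =
  fixes \<mu> L \<theta> \<psi> \<alpha> \<beta> \<gamma> :: real
  assumes mu_pos: "0 < \<mu>" and mu_less_L: "\<mu> < L"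
    and alpha_pos: "0 < \<alpha>" and theta_pos: "0 < \<theta>" and psi_nonneg: "0 \<le> \<psi>"
    and theta_eq: "1 - \<theta> = \<alpha> * L * (1 - \<psi>)"
    and step_psi_le: "\<alpha> * L * \<psi> \<le> 1"
    and step_le: "\<alpha> * L \<le> 3 * \<theta>"
    and rate_condition: "(1 - sqrt (\<theta> * \<alpha> * \<mu>)) *
      (\<theta> + \<alpha> * L * (1 - \<psi>)\<^sup>2 - \<alpha> * \<mu> * \<psi>\<^sup>2) \<le> \<theta> * (1 - \<alpha> * \<psi> * \<mu>)\<^sup>2"
    and beta_eq: "\<beta> = (1 - sqrt (\<theta> * \<alpha> * \<mu>)) / (1 - \<alpha> * \<psi> * \<mu>)
              * (1 - sqrt (\<alpha> * \<mu> / \<theta>))"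
    and gamma_eq: "\<gamma> = \<psi> * \<beta>"
begin

text \<open>
  The contraction factor \<open>\<rho>\<^sup>2\<close> is \<open>1 - r\<close>, and \<open>p\<close>, \<open>m - p\<close> are the two weights of
  \<^const>\<open>lyapunov_vec\<close>, so that \<open>p\<^sup>2 = \<lambda>\<^sub>P\<close>. Rewriting the vector in terms of the current deviation
  and the velocity \<open>x - x'\<close> turns the weights into \<open>m\<close> and \<open>- q\<close>.
\<close>

definition r :: real where "r = sqrt (\<theta> * \<alpha> * \<mu>)"

definition p :: real where "p = sqrt (\<theta> / (2 * \<alpha>))"

definition m :: real where "m = sqrt (\<mu> / 2)"

definition q :: real where "q = m - p"

lemma lyapunov_vec_eq: "lyapunov_vec \<mu> \<theta> \<alpha> u u' = p *\<^sub>R u + (m - p) *\<^sub>R u'"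
  by (simp only: lyapunov_vec_def p_def m_def)

lemma step_mu_psi_less: "\<alpha> * \<psi> * \<mu> < 1"
proof (cases "\<psi> = 0")
  case False
  then have "\<alpha> * \<psi> * \<mu> < \<alpha> * \<psi> * L"
    using psi_nonneg alpha_pos mu_less_L by simp
  with step_psi_le show ?thesis
    by (simp add: mult_ac)
qed simp

lemma sqrt_pos: "0 < \<theta> * \<alpha> * \<mu>"
  using theta_pos alpha_pos mu_pos by simp

lemma sqrt_less: "\<theta> * \<alpha> * \<mu> < 1"
proof -
  have "\<theta> * \<alpha> * \<mu> < \<theta> * (\<alpha> * L)"
    using theta_pos alpha_pos mu_less_L by simp
  also have "\<dots> \<le> (2 - \<alpha> * L) * (\<alpha> * L)"
  proof (rule mult_right_mono)
    show "\<theta> \<le> 2 - \<alpha> * L"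
      using theta_eq step_psi_le by (simp add: algebra_simps)
  qed (use alpha_pos mu_pos mu_less_L in simp)
  also have "\<dots> = 1 - (1 - \<alpha> * L)\<^sup>2"
    by (simp add: algebra_simps power2_eq_square)
  finally show ?thesis
    using zero_le_power2[of "1 - \<alpha> * L"] by linarith
qed

lemma r_pos: "0 < r" and r_less_1: "r < 1"
  using sqrt_pos sqrt_less by (simp_all only: r_def real_sqrt_gt_0_iff real_sqrt_lt_1_iff)

lemma p_sq: "p\<^sup>2 = \<theta> / (2 * \<alpha>)" and r_sq: "r\<^sup>2 = \<theta> * \<alpha> * \<mu>" and m_sq: "m\<^sup>2 = \<mu> / 2"
  using alpha_pos theta_pos sqrt_pos mu_pos
  by (simp_all only: p_def r_def m_def real_sqrt_pow2_iff) simp_all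

lemma p_nonneg: "0 \<le> p"
  using alpha_pos theta_pos by (simp add: p_def)

lemma p_m: "p * m = r / (2 * \<alpha>)"
proof -
  have "\<theta> / (2 * \<alpha>) * (\<mu> / 2) = \<theta> * \<alpha> * \<mu> / (2 * \<alpha>)\<^sup>2"
    using alpha_pos by (simp add: field_simps power2_eq_square)
  then have "p * m = sqrt (\<theta> * \<alpha> * \<mu> / (2 * \<alpha>)\<^sup>2)"
    by (simp only: p_def m_def real_sqrt_mult[symmetric])
  also have "\<dots> = r / (2 * \<alpha>)"
    using alpha_pos by (simp only: real_sqrt_divide real_sqrt_abs r_def)
  finally show ?thesis .
qed

text \<open>
  The momentum parameter is chosen precisely so that this holds: it makes the mixed term of
  position and velocity vanish in \<open>lyapunov_contraction\<close>.
\<close>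

lemma beta_relation: "\<beta> * (1 - \<alpha> * \<psi> * \<mu>) * r = (1 - r) * (r - \<alpha> * \<mu>)"
proof -
  have "\<alpha> * \<mu> / \<theta> = (\<alpha> * \<mu>)\<^sup>2 / (\<theta> * \<alpha> * \<mu>)"
    using alpha_pos mu_pos theta_pos by (simp add: power2_eq_square)
  then have "sqrt (\<alpha> * \<mu> / \<theta>) = \<alpha> * \<mu> / r"
    using alpha_pos mu_pos by (simp only: real_sqrt_divide real_sqrt_abs r_def) simp
  moreover have "\<beta> * (1 - \<alpha> * \<psi> * \<mu>) = (1 - r) * (1 - sqrt (\<alpha> * \<mu> / \<theta>))"
    using step_mu_psi_less unfolding beta_eq r_def by simp
  ultimately have "\<beta> * (1 - \<alpha> * \<psi> * \<mu>) * r = (1 - r) * ((1 - \<alpha> * \<mu> / r) * r)"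
    by simp
  also have "(1 - \<alpha> * \<mu> / r) * r = r - \<alpha> * \<mu>"
    using r_pos by (simp only: left_diff_distrib) simp
  finally show ?thesis .
qed

text \<open>
  The coefficient of the squared velocity in the contraction estimate. Multiplied by
  \<open>2 \<alpha> \<theta> (1 - r)\<close> it becomes, after eliminating \<open>q\<close> by \<open>beta_relation\<close>, the difference of the two
  sides of the rate condition times \<open>\<theta> \<beta>\<^sup>2\<close>.
\<close>

lemma velocity_coefficient_nonpos:
  "p\<^sup>2 * \<beta>\<^sup>2 - (1 - r) * q\<^sup>2 + L / 2 * (\<beta> - \<gamma>)\<^sup>2 - \<mu> / 2 * \<gamma>\<^sup>2 \<le> 0"
    (is "?c \<le> 0")
proof -
  define D where "D = 1 - \<alpha> * \<psi> * \<mu>"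
  have D: "0 < D"
    using step_mu_psi_less by (simp add: D_def)
  have qr: "2 * \<alpha> * \<theta> * q\<^sup>2 = \<theta>\<^sup>2 - 2 * \<theta> * r + r\<^sup>2"
  proof -
    have "q\<^sup>2 = \<mu> / 2 - 2 * (p * m) + p\<^sup>2"
      using m_sq by (simp add: q_def power2_diff)
    then have "2 * \<alpha> * \<theta> * q\<^sup>2 = 2 * \<alpha> * \<theta> * (\<mu> / 2 - 2 * (r / (2 * \<alpha>)) + \<theta> / (2 * \<alpha>))"
      unfolding p_m p_sq by simp
    also have "\<dots> = \<theta> * (\<alpha> * \<mu>) - 2 * \<theta> * r + \<theta>\<^sup>2"
      using alpha_pos by (simp add: field_simps power2_eq_square)
    finally show ?thesis
      unfolding r_sq by simp
  qed
  have "r * (\<beta> * D * \<theta>) = r * ((1 - r) * (\<theta> - r))"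
  proof -
    have "r * (\<beta> * D * \<theta>) = (1 - r) * (\<theta> * r - \<theta> * \<alpha> * \<mu>)"
      using arg_cong[OF beta_relation, of "\<lambda>t. t * \<theta>"] by (simp add: D_def algebra_simps)
    then show ?thesis
      unfolding r_sq[symmetric] by (simp add: algebra_simps power2_eq_square)
  qed
  then have bD: "\<beta> * D * \<theta> = (1 - r) * (\<theta> - r)"
    using r_pos by simp
  have "(1 - r) * (2 * \<alpha> * \<theta> * (p\<^sup>2 * \<beta>\<^sup>2 - (1 - r) * q\<^sup>2 + L / 2 * (\<beta> - \<gamma>)\<^sup>2 - \<mu> / 2 * \<gamma>\<^sup>2))
    = \<theta> * \<beta>\<^sup>2 * ((1 - r) * (\<theta> + \<alpha> * L * (1 - \<psi>)\<^sup>2 - \<alpha> * \<mu> * \<psi>\<^sup>2)) - ((1 - r) * (\<theta> - r))\<^sup>2"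
  proof -
    have "2 * \<alpha> * \<theta> * (p\<^sup>2 * \<beta>\<^sup>2 - (1 - r) * q\<^sup>2 + L / 2 * (\<beta> - \<gamma>)\<^sup>2 - \<mu> / 2 * \<gamma>\<^sup>2)
      = 2 * \<alpha> * \<theta> * p\<^sup>2 * \<beta>\<^sup>2 - (1 - r) * (2 * \<alpha> * \<theta> * q\<^sup>2)
        + \<alpha> * \<theta> * L * (\<beta> - \<gamma>)\<^sup>2 - \<alpha> * \<theta> * \<mu> * \<gamma>\<^sup>2"
      by (simp add: algebra_simps)
    also have "\<dots> = \<theta> * \<beta>\<^sup>2 * (\<theta> + \<alpha> * L * (1 - \<psi>)\<^sup>2 - \<alpha> * \<mu> * \<psi>\<^sup>2) - (1 - r) * (\<theta> - r)\<^sup>2"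
      unfolding qr p_sq gamma_eq using alpha_pos by (simp add: power2_eq_square algebra_simps)
    finally have eq: "2 * \<alpha> * \<theta> * (p\<^sup>2 * \<beta>\<^sup>2 - (1 - r) * q\<^sup>2 + L / 2 * (\<beta> - \<gamma>)\<^sup>2 - \<mu> / 2 * \<gamma>\<^sup>2)
      = \<theta> * \<beta>\<^sup>2 * (\<theta> + \<alpha> * L * (1 - \<psi>)\<^sup>2 - \<alpha> * \<mu> * \<psi>\<^sup>2) - (1 - r) * (\<theta> - r)\<^sup>2" .
    show ?thesis
      unfolding eq by (simp add: power2_eq_square algebra_simps)
  qed
  also have "\<dots> \<le> \<theta> * \<beta>\<^sup>2 * (\<theta> * D\<^sup>2) - (\<beta> * D * \<theta>)\<^sup>2"
    unfolding bD using mult_left_mono[OF rate_condition[folded r_def], of "\<theta> * \<beta>\<^sup>2"] theta_pos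
    by (simp add: D_def)
  also have "\<dots> = 0"
    by (simp add: power2_eq_square)
  finally have le: "(1 - r) * (2 * \<alpha> * \<theta> * ?c) \<le> 0" .
  show ?thesis
  proof (rule ccontr)
    assume "\<not> ?c \<le> 0"
    then have "0 < (1 - r) * (2 * \<alpha> * \<theta> * ?c)"
      using r_less_1 alpha_pos theta_pos by (intro mult_pos_pos) simp_all
    with le show False
      by simp
  qed
qed

definition noiseless_step ::
  "(real ^ 'd \<Rightarrow> real) \<Rightarrow> real ^ 'd \<Rightarrow> real ^ 'd \<Rightarrow> real ^ 'd" where
  "noiseless_step f x x' = (1 + \<beta>) *\<^sub>R x - \<beta> *\<^sub>R x' -
     \<alpha> *\<^sub>R grad f ((1 + \<gamma>) *\<^sub>R x - \<gamma> *\<^sub>R x')"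

abbreviation "V f xs \<equiv> lyapunov f xs (gmm_P \<mu> \<theta> \<alpha>)"

text \<open>
  Bound \<open>f\<close> at the new point by smoothness from \<open>y\<close>, and bound it from below at the old point and
  at \<open>xs\<close> by strong convexity from \<open>y\<close>, the last two with weights \<open>1 - r\<close> and \<open>r\<close>. What is left is a
  quadratic form in the deviation \<open>X\<close>, the velocity \<open>v\<close> and the gradient \<open>g\<close>. The coefficients of
  \<open>X \<bullet> X\<close>, \<open>X \<bullet> v\<close>, \<open>g \<bullet> X\<close> and \<open>g \<bullet> v\<close> are all zero, and those of \<open>g \<bullet> g\<close> and \<open>v \<bullet> v\<close> are nonpositive.
\<close>

lemma lyapunov_contraction:
  fixes f :: "real ^ 'd \<Rightarrow> real"
  assumes sc: "strongly_convex \<mu> f" and sm: "smooth L f"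
  shows "V f xs (noiseless_step f x x') x \<le> (1 - r) * V f xs x x'"
proof -
  define y where "y = (1 + \<gamma>) *\<^sub>R x - \<gamma> *\<^sub>R x'"
  define g where "g = grad f y"
  define X where "X = x - xs"
  define k where "k = r / \<alpha>"
  define v where "v = x - x'"
  define x1 where "x1 = noiseless_step f x x'"
  have diff: "f differentiable (at y)"
    using sm by (simp add: smooth_def)
  have x1_y: "x1 - y = (\<beta> - \<gamma>) *\<^sub>R v - \<alpha> *\<^sub>R g"
    by (simp add: x1_def noiseless_step_def g_def y_def v_def algebra_simps)
  have x_y: "x - y = - (\<gamma> *\<^sub>R v)"
    by (simp add: y_def v_def algebra_simps)
  have xs_y: "xs - y = - (X + \<gamma> *\<^sub>R v)"
    by (simp add: y_def v_def X_def algebra_simps)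
  have up: "f x1 \<le> f y + g \<bullet> ((\<beta> - \<gamma>) *\<^sub>R v - \<alpha> *\<^sub>R g) + L / 2 * (norm ((\<beta> - \<gamma>) *\<^sub>R v - \<alpha> *\<^sub>R g))\<^sup>2"
    using smooth_descent[OF sm, of x1 y] by (simp add: x1_y g_def)
  have low1: "f y - \<gamma> * (g \<bullet> v) + \<mu> / 2 * (\<gamma>\<^sup>2 * (norm v)\<^sup>2) \<le> f x"
    using strongly_convex_tangent[OF sc diff, of x] by (simp add: x_y g_def power_mult_distrib)
  have low2: "f y - g \<bullet> (X + \<gamma> *\<^sub>R v) + \<mu> / 2 * (norm (X + \<gamma> *\<^sub>R v))\<^sup>2 \<le> f xs"
    using strongly_convex_tangent[OF sc diff, of xs]
    by (simp only: xs_y g_def norm_minus_cancel inner_minus_right)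
  have vec1: "lyapunov_vec \<mu> \<theta> \<alpha> (x1 - xs) (x - xs)
      = (p * \<beta>) *\<^sub>R v + m *\<^sub>R X - (p * \<alpha>) *\<^sub>R g"
    by (simp add: lyapunov_vec_eq q_def x1_def noiseless_step_def g_def y_def v_def X_def algebra_simps)
  have vec0: "lyapunov_vec \<mu> \<theta> \<alpha> (x - xs) (x' - xs) = m *\<^sub>R X - q *\<^sub>R v"
    by (simp add: lyapunov_vec_eq q_def v_def X_def algebra_simps)
  have N1: "(norm ((p * \<beta>) *\<^sub>R v + m *\<^sub>R X - (p * \<alpha>) *\<^sub>R g))\<^sup>2
    = p\<^sup>2 * \<beta>\<^sup>2 * (v \<bullet> v) + \<mu> / 2 * (X \<bullet> X) + p\<^sup>2 * \<alpha>\<^sup>2 * (g \<bullet> g) + \<beta> * (r / \<alpha>) * (X \<bullet> v)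
      - 2 * p\<^sup>2 * \<alpha> * \<beta> * (g \<bullet> v) - r * (g \<bullet> X)"
  proof -
    have "(norm ((p * \<beta>) *\<^sub>R v + m *\<^sub>R X - (p * \<alpha>) *\<^sub>R g))\<^sup>2
      = p\<^sup>2 * \<beta>\<^sup>2 * (v \<bullet> v) + m\<^sup>2 * (X \<bullet> X) + p\<^sup>2 * \<alpha>\<^sup>2 * (g \<bullet> g)
        + 2 * \<beta> * (p * m) * (X \<bullet> v)
        - 2 * p\<^sup>2 * \<alpha> * \<beta> * (g \<bullet> v) - 2 * \<alpha> * (p * m) * (g \<bullet> X)"
      unfolding power2_norm_eq_inner
      by (simp add: inner_add_left inner_add_right inner_diff_left inner_diff_right inner_commute
          power2_eq_square algebra_simps)
    then show ?thesis
      unfolding p_m m_sq using alpha_pos by simp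
  qed
  have N0: "(norm (m *\<^sub>R X - q *\<^sub>R v))\<^sup>2
    = \<mu> / 2 * (X \<bullet> X) - (\<mu> - r / \<alpha>) * (X \<bullet> v) + q\<^sup>2 * (v \<bullet> v)"
  proof -
    have "(norm (m *\<^sub>R X - q *\<^sub>R v))\<^sup>2
      = m\<^sup>2 * (X \<bullet> X) - 2 * (m * q) * (X \<bullet> v) + q\<^sup>2 * (v \<bullet> v)"
      unfolding power2_norm_eq_inner
      by (simp add: inner_diff_left inner_diff_right inner_commute power2_eq_square algebra_simps)
    moreover have "m * q = \<mu> / 2 - r / (2 * \<alpha>)"
      unfolding m_sq[symmetric] p_m[symmetric] by (simp add: q_def algebra_simps power2_eq_square)
    ultimately show ?thesis
      unfolding m_sq by (simp add: field_simps)
  qed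
  have Nu: "(norm ((\<beta> - \<gamma>) *\<^sub>R v - \<alpha> *\<^sub>R g))\<^sup>2
    = (\<beta> - \<gamma>)\<^sup>2 * (v \<bullet> v) - 2 * \<alpha> * (\<beta> - \<gamma>) * (g \<bullet> v) + \<alpha>\<^sup>2 * (g \<bullet> g)"
    unfolding power2_norm_eq_inner
    by (simp add: inner_diff_left inner_diff_right inner_commute power2_eq_square algebra_simps)
  have Ns: "(norm (X + \<gamma> *\<^sub>R v))\<^sup>2 = X \<bullet> X + 2 * \<gamma> * (X \<bullet> v) + \<gamma>\<^sup>2 * (v \<bullet> v)"
    unfolding power2_norm_eq_inner
    by (simp add: inner_add_left inner_add_right inner_commute power2_eq_square algebra_simps)
  \<comment> \<open>The coefficient of \<open>X \<bullet> v\<close> is governed by \<open>\<beta>\<close>, those of \<open>g \<bullet> v\<close> and \<open>g \<bullet> g\<close> by \<open>theta_eq\<close>.\<close>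
  have vec_Xv: "\<beta> * (r / \<alpha>) + (1 - r) * (\<mu> - r / \<alpha>) - r * \<mu> * \<gamma> = 0"
  proof -
    have "\<alpha> * (\<beta> * (r / \<alpha>) + (1 - r) * (\<mu> - r / \<alpha>) - r * \<mu> * \<gamma>) =
      \<beta> * (1 - \<alpha> * \<psi> * \<mu>) * r - (1 - r) * (r - \<alpha> * \<mu>)"
      using alpha_pos by (simp add: gamma_eq field_simps)
    then show ?thesis
      using beta_relation alpha_pos by simp
  qed
  have c_vg: "- 2 * p\<^sup>2 * \<alpha> * \<beta> + (\<beta> - \<gamma>) - L * \<alpha> * (\<beta> - \<gamma>) + \<gamma> = 0"
  proof -
    have "- 2 * p\<^sup>2 * \<alpha> * \<beta> + (\<beta> - \<gamma>) - L * \<alpha> * (\<beta> - \<gamma>) + \<gamma> = \<beta> * (1 - \<theta> - \<alpha> * L * (1 - \<psi>))"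
      unfolding p_sq gamma_eq using alpha_pos by (simp add: algebra_simps)
    then show ?thesis
      using theta_eq by simp
  qed
  have c_gg: "p\<^sup>2 * \<alpha>\<^sup>2 - \<alpha> + L / 2 * \<alpha>\<^sup>2 \<le> 0"
  proof -
    have "p\<^sup>2 * \<alpha>\<^sup>2 - \<alpha> + L / 2 * \<alpha>\<^sup>2 = \<alpha> / 2 * (\<theta> + \<alpha> * L - 2)"
      unfolding p_sq using alpha_pos by (simp add: field_simps power2_eq_square)
    also have "\<theta> + \<alpha> * L - 2 = \<alpha> * L * \<psi> - 1"
      using theta_eq by (simp add: algebra_simps)
    finally show ?thesis
      using mult_nonneg_nonpos[of "\<alpha> / 2" "\<alpha> * L * \<psi> - 1"] alpha_pos step_psi_le by simp
  qed
  have "V f xs x1 x - (1 - r) * V f xs x x'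
    \<le> (norm ((p * \<beta>) *\<^sub>R v + m *\<^sub>R X - (p * \<alpha>) *\<^sub>R g))\<^sup>2
      - (1 - r) * (norm (m *\<^sub>R X - q *\<^sub>R v))\<^sup>2
      + (g \<bullet> ((\<beta> - \<gamma>) *\<^sub>R v - \<alpha> *\<^sub>R g) + L / 2 * (norm ((\<beta> - \<gamma>) *\<^sub>R v - \<alpha> *\<^sub>R g))\<^sup>2
      + (1 - r) * (\<gamma> * (g \<bullet> v) - \<mu> / 2 * (\<gamma>\<^sup>2 * (norm v)\<^sup>2))
      + r * (g \<bullet> (X + \<gamma> *\<^sub>R v) - \<mu> / 2 * (norm (X + \<gamma> *\<^sub>R v))\<^sup>2))"
    unfolding lyapunov_eq vec1 vec0
    using up mult_left_mono[OF low1, of "1 - r"] mult_left_mono[OF low2, of r] r_pos r_less_1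
    by (simp add: algebra_simps)
  also have "\<dots> = (p\<^sup>2 * \<alpha>\<^sup>2 - \<alpha> + L / 2 * \<alpha>\<^sup>2) * (g \<bullet> g)
      + (- 2 * p\<^sup>2 * \<alpha> * \<beta> + (\<beta> - \<gamma>) - L * \<alpha> * (\<beta> - \<gamma>) + \<gamma>) * (g \<bullet> v)
      + (\<beta> * (r / \<alpha>) + (1 - r) * (\<mu> - r / \<alpha>) - r * \<mu> * \<gamma>) * (X \<bullet> v)
      + (p\<^sup>2 * \<beta>\<^sup>2 - (1 - r) * q\<^sup>2 + L / 2 * (\<beta> - \<gamma>)\<^sup>2 - \<mu> / 2 * \<gamma>\<^sup>2) * (v \<bullet> v)"
    unfolding N1 N0 Nu Ns power2_norm_eq_inner[of v] inner_diff_right inner_add_right inner_scaleR_right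
      k_def[symmetric]
    by (simp add: algebra_simps add_divide_distrib diff_divide_distrib power2_eq_square)
  also have "\<dots> \<le> 0"
    unfolding vec_Xv c_vg using c_gg velocity_coefficient_nonpos
    by (simp add: mult_nonpos_nonneg add_nonpos_nonpos)
  finally show ?thesis
    by (simp add: x1_def)
qed

text \<open>
  The noise enters only the new iterate, so its effect is linear, in a direction fixed by the
  noise-free step, plus a quadratic remainder with constant \<open>L / 2 + \<lambda>\<^sub>P\<close>.
\<close>

lemma lyapunov_noise_expansion:
  fixes f :: "real ^ 'd \<Rightarrow> real"
  assumes sm: "smooth L f"
  shows "V f xs (x1 - \<alpha> *\<^sub>R w) x \<le> V f xs x1 x
    - \<alpha> * ((grad f x1 + (2 * p) *\<^sub>R lyapunov_vec \<mu> \<theta> \<alpha> (x1 - xs) (x - xs)) \<bullet> w)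
    + \<alpha>\<^sup>2 * (L + 2 * (\<theta> / (2 * \<alpha>))) / 2 * (norm w)\<^sup>2"
proof -
  let ?Q = "lyapunov_vec \<mu> \<theta> \<alpha> (x1 - xs) (x - xs)"
  have vec: "lyapunov_vec \<mu> \<theta> \<alpha> (x1 - \<alpha> *\<^sub>R w - xs) (x - xs) = ?Q - (p * \<alpha>) *\<^sub>R w"
    by (simp add: lyapunov_vec_eq q_def algebra_simps)
  have "(norm (?Q - (p * \<alpha>) *\<^sub>R w))\<^sup>2 = (norm ?Q)\<^sup>2 - 2 * (p * \<alpha>) * (?Q \<bullet> w) + p\<^sup>2 * \<alpha>\<^sup>2 * (norm w)\<^sup>2"
    unfolding power2_norm_eq_inner
    by (simp add: inner_diff_left inner_diff_right inner_commute power2_eq_square algebra_simps)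
  moreover have "f (x1 - \<alpha> *\<^sub>R w) \<le> f x1 - \<alpha> * (grad f x1 \<bullet> w) + L / 2 * (\<alpha>\<^sup>2 * (norm w)\<^sup>2)"
    using smooth_descent[OF sm, of "x1 - \<alpha> *\<^sub>R w" x1] by (simp add: power_mult_distrib)
  ultimately show ?thesis
    unfolding lyapunov_eq vec p_sq[symmetric] by (simp add: inner_add_left algebra_simps add_divide_distrib)
qed

text \<open>
  Both parts of the noise direction are controlled by the Lyapunov function: the gradient by the
  function gap and the other vector by the quadratic term. Weighting the two squares in the ratio
  of these constants adds the constants instead of doubling the larger one.
\<close>

lemma noise_direction_bound:
  fixes f :: "real ^ 'd \<Rightarrow> real"
  assumes sm: "smooth L f" and min: "\<And>y. f xs \<le> f y"
  shows "(norm (grad f x1 + (2 * p) *\<^sub>R lyapunov_vec \<mu> \<theta> \<alpha> (x1 - xs) (x - xs)))\<^sup>2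
    \<le> (2 * L + 4 * (\<theta> / (2 * \<alpha>))) * V f xs x1 x"
proof -
  let ?Q = "lyapunov_vec \<mu> \<theta> \<alpha> (x1 - xs) (x - xs)"
  define l where "l = \<theta> / (2 * \<alpha>)"
  define a b where "a = norm (grad f x1)" and "b = 2 * p * norm ?Q"
  have l: "0 < l" and L: "0 < L"
    using theta_pos alpha_pos mu_pos mu_less_L by (simp_all add: l_def)
  have "norm (grad f x1 + (2 * p) *\<^sub>R ?Q) \<le> a + b"
    using norm_triangle_ineq[of "grad f x1" "(2 * p) *\<^sub>R ?Q"] theta_pos alpha_pos
    using p_nonneg by (simp add: a_def b_def)
  then have "(norm (grad f x1 + (2 * p) *\<^sub>R ?Q))\<^sup>2 \<le> (a + b)\<^sup>2"
    by (simp add: power_mono)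
  also have "\<dots> \<le> (1 + 2 * l / L) * a\<^sup>2 + (1 + L / (2 * l)) * b\<^sup>2"
  proof -
    \<comment> \<open>Young's inequality for \<open>2 a b\<close> with weight \<open>2 l / L\<close>.\<close>
    have "0 \<le> (2 * l * a - L * b)\<^sup>2 / (2 * l * L)"
      using l L by simp
    also have "\<dots> = 2 * l / L * a\<^sup>2 + L / (2 * l) * b\<^sup>2 - 2 * a * b"
      using l L by (simp add: field_simps power2_eq_square)
    finally show ?thesis
      by (simp add: algebra_simps power2_eq_square)
  qed
  also have "\<dots> \<le> (1 + 2 * l / L) * (2 * L * (f x1 - f xs)) + (1 + L / (2 * l)) * (4 * l * (norm ?Q)\<^sup>2)"
  proof (intro add_mono mult_left_mono)
    show "a\<^sup>2 \<le> 2 * L * (f x1 - f xs)"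
      unfolding a_def by (rule norm_grad_le_gap[OF sm L min])
    show "b\<^sup>2 \<le> 4 * l * (norm ?Q)\<^sup>2"
      unfolding b_def power_mult_distrib p_sq by (simp add: l_def)
  qed (use l L in auto)
  also have "\<dots> = (2 * L + 4 * l) * V f xs x1 x"
    unfolding lyapunov_eq using l L by (simp add: field_simps)
  finally show ?thesis
    by (simp add: l_def)
qed

end

section \<open>The admissible region\<close>

text \<open>
  On \<^const>\<open>S_minus\<close> the ratio of \<open>s = \<alpha> L\<close> to \<open>\<theta>\<close> could be as large as the condition number; the
  rate condition is what keeps it below \<open>3\<close>. The constant is sharp: with \<open>k = \<mu> / L = 1 / 3\<close>,
  \<open>\<psi> = 2 / 3\<close>, \<open>\<theta> = 1 / 2\<close> and \<open>s = 3 / 2\<close> the rate condition holds with equality.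

  In terms of \<open>c = s \<psi>\<close> we have \<open>\<theta> = 1 + c - s\<close>. If \<open>s > 3 \<theta>\<close>, then replacing \<open>s\<close> by
  \<open>3 (1 + c) / 4\<close> only weakens the rate condition, and the root can be bounded by the inequality
  of arithmetic and geometric means, which is tight at \<open>k = 1 / 3\<close>. What remains is a polynomial
  inequality in \<open>c\<close> and \<open>N = 3 k\<close> which fails for \<open>0 \<le> c \<le> 1\<close> and \<open>0 \<le> N \<le> 3\<close>.
\<close>

lemma step_le_three_theta:
  fixes k s \<theta> \<psi> :: real
  assumes k: "0 < k" "k < 1" and s: "0 < s" and \<psi>: "0 \<le> \<psi>" and c_le: "s * \<psi> \<le> 1"
    and theta: "\<theta> = 1 - s * (1 - \<psi>)" "0 < \<theta>"
    and rate: "(1 - sqrt (\<theta> * (k * s))) * (\<theta> + s * (1 - \<psi>)\<^sup>2 - k * s * \<psi>\<^sup>2)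
      \<le> \<theta> * (1 - k * s * \<psi>)\<^sup>2"
  shows "s \<le> 3 * \<theta>"
proof (rule ccontr)
  assume "\<not> s \<le> 3 * \<theta>"
  define c where "c = s * \<psi>"
  define N where "N = 3 * k"
  define m where "m = 3 * (1 + c)\<^sup>2 / 16"
  have c: "0 \<le> c" "c \<le> 1"
    using s \<psi> c_le by (simp_all add: c_def)
  have theta_c: "\<theta> = 1 + c - s"
    using theta(1) by (simp add: c_def algebra_simps)
  have s_gt: "3 * (1 + c) / 4 < s"
    using \<open>\<not> s \<le> 3 * \<theta>\<close> theta_c by simp
  have m_gt: "s * \<theta> < m"
  proof -
    have "m - s * \<theta> = (s - 3 * (1 + c) / 4) * (s - (1 + c) / 4)"
      by (simp add: m_def theta_c field_simps power2_eq_square)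
    also have "\<dots> > 0"
      using s_gt c by (intro mult_pos_pos) simp_all
    finally show ?thesis
      by simp
  qed
  have sqrt_le: "sqrt (\<theta> * (k * s)) \<le> (1 + N) * (1 + c) / 8"
  proof (rule real_le_lsqrt)
    have "\<theta> * (k * s) \<le> k * m"
      using mult_left_mono[of "s * \<theta>" m k] m_gt k by (simp add: mult_ac)
    also have "\<dots> \<le> ((1 + N) * (1 + c) / 8)\<^sup>2"
    proof -
      have "((1 + N) * (1 + c) / 8)\<^sup>2 - k * m = ((1 - N) * (1 + c) / 8)\<^sup>2"
        by (simp add: m_def N_def field_simps power2_eq_square)
      then show ?thesis
        using zero_le_power2[of "(1 - N) * (1 + c) / 8"] by linarith
    qed
    finally show "\<theta> * (k * s) \<le> ((1 + N) * (1 + c) / 8)\<^sup>2" .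
  qed (use k c s theta in \<open>simp_all add: N_def\<close>)
  have pos: "(1 + N) * (1 + c) / 8 \<le> 1"
    using mult_mono[of "1 + N" 4 "1 + c" 2] k c by (simp add: N_def)
  have kc: "0 < 1 - k * c"
    using mult_left_mono[of c 1 k] k c by linarith
  have "(1 - (1 + N) * (1 + c) / 8) * (3 * (1 + c) / 4 * (1 - c) + (1 - k) * c\<^sup>2)
    \<le> (1 - sqrt (\<theta> * (k * s))) * (s * (1 - c) + (1 - k) * c\<^sup>2)"
  proof (rule mult_mono)
    show "3 * (1 + c) / 4 * (1 - c) + (1 - k) * c\<^sup>2 \<le> s * (1 - c) + (1 - k) * c\<^sup>2"
      using s_gt c by (intro add_mono mult_right_mono) simp_all
    show "1 - (1 + N) * (1 + c) / 8 \<le> 1 - sqrt (\<theta> * (k * s))"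
      using sqrt_le by linarith
    show "0 \<le> 1 - sqrt (\<theta> * (k * s))"
      using sqrt_le pos by linarith
  qed (use c k in simp)
  also have "\<dots> = s * ((1 - sqrt (\<theta> * (k * s))) * (\<theta> + s * (1 - \<psi>)\<^sup>2 - k * s * \<psi>\<^sup>2))"
  proof -
    have "s * (1 - c) + (1 - k) * c\<^sup>2 = s * (\<theta> + s * (1 - \<psi>)\<^sup>2 - k * s * \<psi>\<^sup>2)"
      by (simp add: theta(1) c_def algebra_simps power2_eq_square)
    then show ?thesis
      by simp
  qed
  also have "\<dots> \<le> s * (\<theta> * (1 - k * s * \<psi>)\<^sup>2)"
    using rate s by (intro mult_left_mono) simp_all
  also have "\<dots> = s * \<theta> * (1 - k * c)\<^sup>2"
    by (simp add: c_def mult_ac)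
  also have "\<dots> < m * (1 - k * c)\<^sup>2"
    using m_gt kc by simp
  \<comment> \<open>The factor clears denominators; the difference then has the divisor \<open>1 - c\<close>, with cofactor expanded at \<open>N = 3\<close>.\<close>
  finally have "96 * ((1 - (1 + N) * (1 + c) / 8) * (3 * (1 + c) / 4 * (1 - c) + (1 - k) * c\<^sup>2))
      < 96 * (m * (1 - k * c)\<^sup>2)"
    by simp
  moreover have "96 * ((1 - (1 + N) * (1 + c) / 8) * (3 * (1 + c) / 4 * (1 - c) + (1 - k) * c\<^sup>2))
      - 96 * (m * (1 - k * c)\<^sup>2)
    = (1 - c) * (18 * (1 - c)\<^sup>2 * (1 + c)
        + (3 - N) * (9 + 6 * c + 13 * c\<^sup>2 - 2 * c\<^sup>2 * (1 + c) * (N + 3)))"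
    by (simp add: m_def N_def field_simps power2_eq_square)
  moreover have "0 \<le> (1 - c) * (18 * (1 - c)\<^sup>2 * (1 + c)
        + (3 - N) * (9 + 6 * c + 13 * c\<^sup>2 - 2 * c\<^sup>2 * (1 + c) * (N + 3)))"
  proof -
    have "2 * c\<^sup>2 * (1 + c) * (N + 3) \<le> 2 * c\<^sup>2 * (1 + c) * 6"
      using k c by (intro mult_left_mono) (simp_all add: N_def)
    moreover have "c * c\<^sup>2 \<le> c" "c\<^sup>2 \<le> c"
      using c power2_le_iff_abs_le[of 1 c] mult_left_mono[of "c\<^sup>2" 1 c] mult_left_mono[of c 1 c]
      by (simp_all add: power_le_one power2_eq_square)
    moreover have "2 * c\<^sup>2 * (1 + c) * 6 = 12 * c\<^sup>2 + 12 * (c * c\<^sup>2)"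
      by (simp add: algebra_simps)
    moreover have "0 \<le> c\<^sup>2"
      by simp
    ultimately have "0 \<le> 9 + 6 * c + 13 * c\<^sup>2 - 2 * c\<^sup>2 * (1 + c) * (N + 3)"
      using c by linarith
    then show ?thesis
      using c k by (simp add: N_def)
  qed
  ultimately show False
    by linarith
qed

text \<open>
  On each piece of the admissible region the bounds on \<open>\<theta>\<close> say that \<open>\<alpha> L \<psi> \<le> 1\<close>. With the
  values of \<open>S_zero\<close> the rate condition reads \<open>\<alpha> \<mu> \<le> sqrt (\<alpha> \<mu>)\<close>, hence \<open>\<alpha> \<mu> \<le> 1\<close>.
\<close>

lemma admissible_gmm_parameters:
  assumes mu: "0 < \<mu>" "\<mu> < L"
    and adm: "(\<theta>, \<psi>) \<in> S_zero \<union> S_c \<mu> L"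
    and alpha_c: "(\<theta>, \<psi>) \<in> S_c \<mu> L \<Longrightarrow> \<alpha> = (1 - \<theta>) / (L * (1 - \<psi>))"
    and alpha_0: "(\<theta>, \<psi>) \<in> S_zero \<Longrightarrow> 0 < \<alpha> \<and> \<alpha> \<le> 1 / L"
    and beta: "\<beta> = (1 - sqrt (\<theta> * \<alpha> * \<mu>)) / (1 - \<alpha> * \<psi> * \<mu>) * (1 - sqrt (\<alpha> * \<mu> / \<theta>))"
    and gamma: "\<gamma> = \<psi> * \<beta>"
  shows "gmm_parameters \<mu> L \<theta> \<psi> \<alpha> \<beta> \<gamma>"
proof (cases "(\<theta>, \<psi>) \<in> S_zero")
  case True
  then have one: "\<theta> = 1" "\<psi> = 1"
    by (simp_all add: S_zero_def)
  have \<alpha>: "0 < \<alpha>" "\<alpha> * L \<le> 1"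
    using alpha_0[OF True] mu by (simp_all add: field_simps)
  have am: "0 < \<alpha> * \<mu>" "\<alpha> * \<mu> < 1"
    using \<alpha> mu mult_strict_left_mono[OF mu(2) \<alpha>(1)] by (simp, linarith)
  have "\<alpha> * \<mu> \<le> sqrt (\<alpha> * \<mu>)"
    using am by (intro real_le_rsqrt) (simp add: power2_eq_square mult_le_one mult_left_le)
  then have "(1 - sqrt (\<alpha> * \<mu>)) * (1 - \<alpha> * \<mu>) \<le> (1 - \<alpha> * \<mu>)\<^sup>2"
    using am by (simp add: power2_eq_square mult_right_mono)
  with one \<alpha> mu beta gamma show ?thesis
    by unfold_locales simp_all
next
  case False
  with adm have Sc: "(\<theta>, \<psi>) \<in> S_c \<mu> L"
    by blast
  then have one: "(\<theta>, \<psi>) \<in> S_one \<mu> L" and sgn: "(\<theta>, \<psi>) \<in> S_minus (L / \<mu>) \<union> S_plus"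
    by (simp_all add: S_c_def)
  have ne: "\<psi> \<noteq> 1"
    using one by (simp add: S_one_def)
  have L: "0 < L"
    using mu by simp
  have \<alpha>: "\<alpha> = (1 - \<theta>) / (L * (1 - \<psi>))"
    by (rule alpha_c[OF Sc])
  have theta_eq: "1 - \<theta> = \<alpha> * L * (1 - \<psi>)"
    using ne L by (simp add: \<alpha>)
  have signs: "0 < \<alpha> \<and> 0 < \<theta> \<and> 0 \<le> \<psi> \<and> \<alpha> * L * \<psi> \<le> 1"
    using sgn
  proof
    assume "(\<theta>, \<psi>) \<in> S_plus"
    then have "\<psi> > 1" "1 < \<theta>" "\<theta> \<le> 2 - 1 / \<psi>"
      by (simp_all add: S_plus_def)
    moreover from this have "(1 - \<theta>) / (1 - \<psi>) * \<psi> \<le> 1"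
      by (simp add: field_simps)
    ultimately show ?thesis
      using L by (simp add: \<alpha> divide_neg_neg mult_pos_neg)
  next
    assume "(\<theta>, \<psi>) \<in> S_minus (L / \<mu>)"
    then have \<psi>: "0 \<le> \<psi>" "\<psi> < 1" "\<theta> < 1" and low: "1 / (1 + L / \<mu> * (1 - \<psi>)) \<le> \<theta>"
      and up: "\<psi> \<noteq> 0 \<Longrightarrow> 2 - 1 / \<psi> \<le> \<theta>"
      by (auto simp: S_minus_def split: if_splits)
    have "0 < 1 / (1 + L / \<mu> * (1 - \<psi>))"
      using \<psi> mu by (simp add: add_pos_nonneg)
    with low have "0 < \<theta>"
      by linarith
    moreover have "(1 - \<theta>) / (1 - \<psi>) * \<psi> \<le> 1"
      using \<psi> up by (cases "\<psi> = 0") (simp_all add: field_simps)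
    ultimately show ?thesis
      using \<psi> L by (simp add: \<alpha>)
  qed
  have am_psi: "(1 - \<theta>) * \<psi> / (L / \<mu> * (1 - \<psi>)) = \<alpha> * \<psi> * \<mu>"
    and am_theta: "(1 - \<theta>) * \<theta> / (L / \<mu> * (1 - \<psi>)) = \<theta> * \<alpha> * \<mu>"
    and am_x: "(1 - \<theta>) * x / (L * (1 - \<psi>) * \<theta>) = \<alpha> * x / \<theta>" for x
    using L mu ne by (simp_all add: \<alpha>)
  have "(1 - sqrt (\<theta> * \<alpha> * \<mu>)) * (1 - \<alpha> * (\<mu> * \<psi>\<^sup>2 - L * (1 - \<psi>)\<^sup>2) / \<theta>) \<le> (1 - \<alpha> * \<psi> * \<mu>)\<^sup>2"
    using one unfolding S_one_def mem_Collect_eq prod.case am_psi am_theta am_x by simp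
  then have "\<theta> * ((1 - sqrt (\<theta> * \<alpha> * \<mu>)) * (1 - \<alpha> * (\<mu> * \<psi>\<^sup>2 - L * (1 - \<psi>)\<^sup>2) / \<theta>))
      \<le> \<theta> * (1 - \<alpha> * \<psi> * \<mu>)\<^sup>2"
    using signs by (intro mult_left_mono) simp_all
  also have "\<theta> * ((1 - sqrt (\<theta> * \<alpha> * \<mu>)) * (1 - \<alpha> * (\<mu> * \<psi>\<^sup>2 - L * (1 - \<psi>)\<^sup>2) / \<theta>))
    = (1 - sqrt (\<theta> * \<alpha> * \<mu>)) * (\<theta> + \<alpha> * L * (1 - \<psi>)\<^sup>2 - \<alpha> * \<mu> * \<psi>\<^sup>2)"
  proof -
    have "\<theta> * (1 - \<alpha> * (\<mu> * \<psi>\<^sup>2 - L * (1 - \<psi>)\<^sup>2) / \<theta>)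
      = \<theta> + \<alpha> * L * (1 - \<psi>)\<^sup>2 - \<alpha> * \<mu> * \<psi>\<^sup>2"
      using signs by (simp add: field_simps)
    then show ?thesis
      by (simp only: mult.left_commute[of \<theta>])
  qed
  finally have rate: "(1 - sqrt (\<theta> * \<alpha> * \<mu>)) * (\<theta> + \<alpha> * L * (1 - \<psi>)\<^sup>2 - \<alpha> * \<mu> * \<psi>\<^sup>2)
    \<le> \<theta> * (1 - \<alpha> * \<psi> * \<mu>)\<^sup>2" .
  have am_eq: "\<mu> / L * (\<alpha> * L) = \<alpha> * \<mu>"
    using L by simp
  have "\<alpha> * L \<le> 3 * \<theta>"
  proof (rule step_le_three_theta)
    show "(1 - sqrt (\<theta> * (\<mu> / L * (\<alpha> * L)))) *
      (\<theta> + \<alpha> * L * (1 - \<psi>)\<^sup>2 - \<mu> / L * (\<alpha> * L) * \<psi>\<^sup>2) \<le> \<theta> * (1 - \<mu> / L * (\<alpha> * L) * \<psi>)\<^sup>2"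
      unfolding am_eq using rate by (simp only: mult.assoc mult.left_commute mult.commute)
  qed (use mu signs theta_eq in simp_all)
  with signs theta_eq rate mu beta gamma show ?thesis
    by unfold_locales simp_all
qed

section \<open>Exponential moments of sub-Gaussian noise\<close>

lemma exp_half_ge: "8 / 5 + 1 / 25 \<le> exp (1 / 2 :: real)"
proof -
  have "(41 / 32)\<^sup>2 \<le> (exp (1 / 4 :: real))\<^sup>2"
    using exp_lower_Taylor_quadratic[of "1 / 4"] by (intro power_mono) (simp_all add: power2_eq_square)
  also have "\<dots> = exp (1 / 2)"
    by (simp flip: exp_double)
  finally show ?thesis
    by (simp add: power2_eq_square)
qed

text \<open>
  The point of this bound is the affine term: it has mean zero for centered noise, and what is
  left grows like the square of \<open>x\<close>. For \<open>x \<le> 4/3\<close> it follows by comparing Taylor polynomials;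
  beyond that \<open>x \<le> 3/4 x\<^sup>2\<close>.
\<close>

lemma exp_le_affine_plus_gauss:
  fixes x :: real
  shows "exp x \<le> x + exp (3 / 4 * x\<^sup>2)"
proof -
  consider "x < 0" | "0 \<le> x" "x \<le> 4 / 3" | "4 / 3 < x"
    by linarith
  then show ?thesis
  proof cases
    case 1
    have "(1 + x + x\<^sup>2 / 2) * (1 - x + x\<^sup>2 / 2) = 1 + (x\<^sup>2)\<^sup>2 / 4"
      by (simp add: algebra_simps power2_eq_square)
    then have "1 \<le> (1 + x + x\<^sup>2 / 2) * (1 - x + x\<^sup>2 / 2)"
      by simp
    also have "\<dots> \<le> (1 + x + x\<^sup>2 / 2) * exp (- x)"
    proof (rule mult_left_mono)
      show "1 - x + x\<^sup>2 / 2 \<le> exp (- x)"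
        using exp_lower_Taylor_quadratic[of "- x"] 1 by simp
      show "0 \<le> 1 + x + x\<^sup>2 / 2"
        using zero_le_power2[of "1 + x"] by (simp add: power2_eq_square algebra_simps)
    qed
    finally have "exp x \<le> 1 + x + x\<^sup>2 / 2"
      by (simp add: exp_minus field_simps)
    also have "\<dots> \<le> x + (1 + 3 / 4 * x\<^sup>2)"
      by simp
    also have "\<dots> \<le> x + exp (3 / 4 * x\<^sup>2)"
      by (intro add_left_mono exp_ge_add_one_self)
    finally show ?thesis .
  next
    case 2
    obtain t where t: "\<bar>t\<bar> \<le> \<bar>x\<bar>" "exp x = (\<Sum>m<4. x ^ m / fact m) + exp t / fact 4 * x ^ 4"
      using Maclaurin_exp_le[of x 4] by blast
    have "exp t \<le> exp (1 + 1 / 3)"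
      using t(1) 2 by simp
    also have "\<dots> = exp 1 * exp (1 / 3)"
      by (rule exp_add)
    also have "\<dots> \<le> 3 * (13 / 9)"
      using exp_le exp_bound[of "1 / 3"] by (intro mult_mono) (simp_all add: power2_eq_square)
    finally have "exp t / 24 * x ^ 4 \<le> 5 / 24 * x ^ 4"
      by (intro mult_right_mono divide_right_mono) simp_all
    then have "exp x \<le> 1 + x + x\<^sup>2 / 2 + x ^ 3 / 6 + 5 / 24 * x ^ 4"
      using t(2) by (simp add: numeral_eq_Suc)
    also have "\<dots> \<le> x + (1 + 3 / 4 * x\<^sup>2 + (3 / 4 * x\<^sup>2)\<^sup>2 / 2)"
    proof -
      have "x + (1 + 3 / 4 * x\<^sup>2 + (3 / 4 * x\<^sup>2)\<^sup>2 / 2) - (1 + x + x\<^sup>2 / 2 + x ^ 3 / 6 + 5 / 24 * x ^ 4)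
        = x\<^sup>2 * ((1 / 2 - x / 6)\<^sup>2 + 13 / 288 * x\<^sup>2)"
        by (simp add: field_simps power2_eq_square eval_nat_numeral)
      moreover have "0 \<le> x\<^sup>2 * ((1 / 2 - x / 6)\<^sup>2 + 13 / 288 * x\<^sup>2)"
        by simp
      ultimately show ?thesis
        by linarith
    qed
    also have "\<dots> \<le> x + exp (3 / 4 * x\<^sup>2)"
      by (intro add_left_mono exp_lower_Taylor_quadratic) simp
    finally show ?thesis .
  next
    case 3
    then have "x * 1 \<le> x * (3 / 4 * x)"
      by (intro mult_left_mono) simp_all
    then have "exp x \<le> exp (3 / 4 * x\<^sup>2)"
      by (simp add: power2_eq_square mult_ac)
    with 3 show ?thesis
      by linarith
  qed
qed

text \<open>
  The tangent of the exponential function at \<open>1 / 2\<close>, applied to \<open>3/4 x\<^sup>2\<close>; the resulting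
  quadratic in \<open>x\<close> stays barely above the line \<open>2 x\<close>.
\<close>

lemma double_le_exp_gauss:
  fixes x :: real
  shows "2 * x \<le> exp (3 / 4 * x\<^sup>2)"
proof -
  have "2 * x \<le> 41 / 25 * (1 / 2 + 3 / 4 * x\<^sup>2)"
  proof -
    have "41 / 25 * (1 / 2 + 3 / 4 * x\<^sup>2) - 2 * x = 123 / 100 * (x - 100 / 123)\<^sup>2 + 43 / 6150"
      by (simp add: field_simps power2_eq_square)
    moreover have "0 \<le> 123 / 100 * (x - 100 / 123)\<^sup>2"
      by simp
    ultimately show ?thesis
      by linarith
  qed
  also have "\<dots> \<le> exp (1 / 2) * exp (3 / 4 * x\<^sup>2 - 1 / 2)"
    using exp_half_ge exp_ge_add_one_self[of "3 / 4 * x\<^sup>2 - 1 / 2"]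
    by (intro mult_mono) simp_all
  also have "\<dots> = exp (3 / 4 * x\<^sup>2)"
    by (simp flip: exp_add)
  finally show ?thesis .
qed

text \<open>
  The factor of \<open>t\<close> is \<open>3/2\<close>, since then the exponent on the right, multiplied by the factor \<open>8/3\<close>
  of \<open>geometric_moment_le_exp\<close>, is \<open>2 x\<^sup>2 + 4 t\<close>, which gives the constants of \<open>subgaussian_mgf\<close>. The
  loss \<open>x (exp t - 1)\<close> in passing from \<open>t = 0\<close> to \<open>t\<close> is covered by \<open>exp (t / 2) \<ge> 1 + t / 2\<close> because
  of \<open>double_le_exp_gauss\<close>.
\<close>

lemma exp_add_le_affine_plus_gauss:
  fixes x t :: real
  assumes "0 \<le> t"
  shows "exp (x + t) \<le> x + exp (3 / 4 * x\<^sup>2 + 3 / 2 * t)"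
proof -
  have et: "1 \<le> exp t" "exp t - 1 \<le> t * exp t"
    using assms exp_ge_add_one_self[of "- t"] by (simp_all add: exp_minus field_simps)
  have "exp (x + t) - x \<le> exp t * (exp x - x) + x * (exp t - 1)"
    by (simp add: exp_add algebra_simps)
  also have "\<dots> \<le> exp t * exp (3 / 4 * x\<^sup>2) + exp t * (t / 2 * exp (3 / 4 * x\<^sup>2))"
  proof (rule add_mono)
    show "exp t * (exp x - x) \<le> exp t * exp (3 / 4 * x\<^sup>2)"
      using exp_le_affine_plus_gauss[of x] by simp
    have "x * (exp t - 1) \<le> exp (3 / 4 * x\<^sup>2) / 2 * (exp t - 1)"
      using double_le_exp_gauss[of x] et(1) by (intro mult_right_mono) simp_all
    also have "\<dots> \<le> exp (3 / 4 * x\<^sup>2) / 2 * (t * exp t)"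
      using et(2) by (intro mult_left_mono) simp_all
    finally show "x * (exp t - 1) \<le> exp t * (t / 2 * exp (3 / 4 * x\<^sup>2))"
      by (simp add: mult_ac)
  qed
  also have "\<dots> = exp t * exp (3 / 4 * x\<^sup>2) * (1 + t / 2)"
    by (simp add: algebra_simps)
  also have "\<dots> \<le> exp t * exp (3 / 4 * x\<^sup>2) * exp (t / 2)"
    by (intro mult_left_mono exp_ge_add_one_self) simp
  also have "\<dots> = exp (3 / 4 * x\<^sup>2 + 3 / 2 * t)"
    by (simp flip: exp_add)
  finally show ?thesis
    by simp
qed

text \<open>
  The logarithm of the quotient of the two sides increases on \<open>[0, 1/2]\<close>, since its derivative
  \<open>8/3 - 2/(1 - q\<^sup>2)\<close> vanishes at \<open>1/2\<close>, and decreases afterwards. So only the end points matter,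
  and at \<open>3/4\<close> the claim is \<open>7 \<le> exp 2\<close>.
\<close>

lemma geometric_moment_le_exp:
  fixes q :: real
  assumes "0 \<le> q" "q \<le> 3 / 4"
  shows "(1 + q) / (1 - q) \<le> exp (8 / 3 * q)"
proof -
  define h where "h q = 8 / 3 * q - ln (1 + q) + ln (1 - q)" for q :: real
  have der: "(h has_real_derivative 8 / 3 - 2 / (1 - t\<^sup>2)) (at t)" if "0 \<le> t" "t \<le> 3 / 4" for t
  proof -
    have "(h has_real_derivative 8 / 3 - 1 / (1 + t) + - 1 / (1 - t)) (at t)"
      unfolding h_def using that by (auto intro!: derivative_eq_intros)
    moreover have "8 / 3 - 1 / (1 + t) + - 1 / (1 - t) = 8 / 3 - 2 / (1 - t\<^sup>2)"
    proof -
      have "(1 + t) * (1 - t) \<noteq> 0"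
        using that by simp
      moreover have "1 - t\<^sup>2 = (1 + t) * (1 - t)"
        by (simp add: algebra_simps power2_eq_square)
      moreover have "1 / (1 + t) + 1 / (1 - t) = 2 / ((1 + t) * (1 - t))"
        using that by (simp add: add_frac_eq)
      ultimately show ?thesis
        by simp
    qed
    ultimately show ?thesis
      by (simp only:)
  qed
  have "0 \<le> h q"
  proof (cases "q \<le> 1 / 2")
    case True
    have "h 0 \<le> h q"
    proof (rule DERIV_nonneg_imp_nondecreasing[of 0 q h])
      fix t assume t: "0 \<le> t" "t \<le> q"
      then have "t\<^sup>2 \<le> (1 / 2)\<^sup>2"
        using True by (intro power_mono) simp_all
      then have "2 / (1 - t\<^sup>2) \<le> 8 / 3"
        by (simp add: field_simps power2_eq_square)
      then show "\<exists>y. (h has_real_derivative y) (at t) \<and> 0 \<le> y"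
        using der[of t] t assms by (intro exI[of _ "8 / 3 - 2 / (1 - t\<^sup>2)"]) simp
    qed (use assms in simp)
    then show ?thesis
      by (simp add: h_def)
  next
    case False
    have "h (3 / 4) \<le> h q"
    proof (rule DERIV_nonpos_imp_nonincreasing[of q "3 / 4" h])
      fix t assume t: "q \<le> t" "t \<le> 3 / 4"
      then have "(1 / 2)\<^sup>2 \<le> t\<^sup>2" "t\<^sup>2 \<le> (3 / 4)\<^sup>2"
        using False by (intro power_mono; simp)+
      then have "8 / 3 \<le> 2 / (1 - t\<^sup>2)"
        by (simp add: field_simps power2_eq_square)
      then show "\<exists>y. (h has_real_derivative y) (at t) \<and> y \<le> 0"
        using der[of t] t assms by (intro exI[of _ "8 / 3 - 2 / (1 - t\<^sup>2)"]) simp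
    qed (use assms in simp)
    moreover have "0 \<le> h (3 / 4)"
    proof -
      have "(41 / 25) ^ 4 \<le> exp (1 / 2 :: real) ^ 4"
        using exp_half_ge by (intro power_mono) simp_all
      also have "\<dots> = exp 2"
        by (simp flip: exp_of_nat_mult)
      finally have "(7::real) \<le> exp 2"
        by (simp add: eval_nat_numeral)
      then have "ln 7 \<le> (2::real)"
        by (simp add: ln_le_cancel_iff[of 7 "exp 2", symmetric] del: ln_le_cancel_iff)
      moreover have "ln (7 / 4) = ln 7 + ln (1 / 4 :: real)"
        using ln_mult[of 7 "1 / 4 :: real"] by simp
      ultimately show ?thesis
        by (simp add: h_def)
    qed
    ultimately show ?thesis
      by simp
  qed
  then have "ln ((1 + q) / (1 - q)) \<le> 8 / 3 * q"
    using assms by (simp add: h_def ln_div)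
  then show ?thesis
    using assms by (simp add: ln_le_cancel_iff[of _ "exp _", symmetric] del: ln_le_cancel_iff)
qed

text \<open>
  Layer cake: \<open>exp (q \<tau>)\<close> is \<open>1\<close> plus the integral of \<open>q exp (q s)\<close> over \<open>0 \<le> s \<le> \<tau>\<close>; exchange the
  integrals and insert the tail bound.
\<close>

lemma (in prob_space) exponential_moment_of_tail:
  fixes \<tau> :: "'a \<Rightarrow> real"
  assumes [measurable]: "\<tau> \<in> borel_measurable M" and nonneg: "\<And>\<omega>. 0 \<le> \<tau> \<omega>"
    and tail: "\<And>s. 0 \<le> s \<Longrightarrow> prob {\<omega> \<in> space M. s \<le> \<tau> \<omega>} \<le> 2 * exp (- s)"
    and q: "0 \<le> q" "q < 1"
  shows "(\<integral>\<^sup>+\<omega>. ennreal (exp (q * \<tau> \<omega>)) \<partial>M) \<le> ennreal ((1 + q) / (1 - q))"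
proof -
  interpret pair_sigma_finite lborel M ..
  let ?g = "\<lambda>s \<omega>. if 0 \<le> s \<and> s \<le> \<tau> \<omega> then ennreal (q * exp (q * s)) else 0"
  have layer: "ennreal (exp (q * \<tau> \<omega>)) = 1 + (\<integral>\<^sup>+s. ?g s \<omega> \<partial>lborel)" for \<omega>
  proof -
    have "(\<integral>\<^sup>+s. ?g s \<omega> \<partial>lborel)
        = (\<integral>\<^sup>+s. ennreal (q * exp (q * s)) * indicator {0..\<tau> \<omega>} s \<partial>lborel)"
      by (intro nn_integral_cong) simp
    also have "\<dots> = ennreal (exp (q * \<tau> \<omega>) - exp (q * 0))"
      using nonneg q by (intro nn_integral_FTC_Icc) (auto intro!: derivative_eq_intros)
    also have "1 + \<dots> = ennreal (1 + (exp (q * \<tau> \<omega>) - exp (q * 0)))"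
      using nonneg[of \<omega>] q by (subst ennreal_plus) simp_all
    finally show ?thesis
      by simp
  qed
  have "(\<integral>\<^sup>+\<omega>. ennreal (exp (q * \<tau> \<omega>)) \<partial>M) = 1 + (\<integral>\<^sup>+\<omega>. \<integral>\<^sup>+s. ?g s \<omega> \<partial>lborel \<partial>M)"
    unfolding layer by (subst nn_integral_add) (simp_all add: emeasure_space_1)
  also have "(\<integral>\<^sup>+\<omega>. \<integral>\<^sup>+s. ?g s \<omega> \<partial>lborel \<partial>M) = (\<integral>\<^sup>+s. \<integral>\<^sup>+\<omega>. ?g s \<omega> \<partial>M \<partial>lborel)"
    by (rule Fubini') measurable
  also have "\<dots> \<le> (\<integral>\<^sup>+s. ennreal (2 * q * exp (- (1 - q) * s)) * indicator {0..} s \<partial>lborel)"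
  proof (rule nn_integral_mono)
    fix s :: real
    show "(\<integral>\<^sup>+\<omega>. ?g s \<omega> \<partial>M) \<le> ennreal (2 * q * exp (- (1 - q) * s)) * indicator {0..} s"
    proof (cases "0 \<le> s")
      case True
      have "(\<integral>\<^sup>+\<omega>. ?g s \<omega> \<partial>M)
          = (\<integral>\<^sup>+\<omega>. ennreal (q * exp (q * s)) * indicator {\<omega> \<in> space M. s \<le> \<tau> \<omega>} \<omega> \<partial>M)"
        using True by (intro nn_integral_cong) (auto split: split_indicator)
      also have "\<dots> = ennreal (q * exp (q * s)) * emeasure M {\<omega> \<in> space M. s \<le> \<tau> \<omega>}"
        by (rule nn_integral_cmult_indicator) measurable
      also have "\<dots> \<le> ennreal (q * exp (q * s)) * ennreal (2 * exp (- s))"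
        using tail[OF True] by (intro mult_left_mono) (simp_all add: emeasure_eq_measure)
      also have "\<dots> = ennreal (2 * q * exp (- (1 - q) * s))"
      proof -
        have "exp (q * s) * exp (- s) = exp (- (1 - q) * s)"
          by (simp add: algebra_simps flip: exp_add)
        then show ?thesis
          using q by (simp add: ennreal_mult[symmetric] mult_ac)
      qed
      finally show ?thesis
        using True by simp
    qed simp
  qed
  also have "\<dots> = ennreal (0 - (- (2 * q / (1 - q)) * exp (- (1 - q) * 0)))"
  proof (rule nn_integral_FTC_atLeast)
    have "((\<lambda>s. - (2 * q / (1 - q)) * exp (- (1 - q) * s)) \<longlongrightarrow> - (2 * q / (1 - q)) * 0) at_top"
      using q by (intro tendsto_intros filterlim_compose[OF exp_at_bot]
          filterlim_tendsto_neg_mult_at_bot[OF tendsto_const] filterlim_ident) simp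
    then show "((\<lambda>s. - (2 * q / (1 - q)) * exp (- (1 - q) * s)) \<longlongrightarrow> 0) at_top"
      by simp
    fix s :: real
    have "((\<lambda>s. - (2 * q / (1 - q)) * exp (- (1 - q) * s)) has_real_derivative
        - (2 * q / (1 - q)) * (exp (- (1 - q) * s) * (- (1 - q)))) (at s)"
      using q by (auto intro!: derivative_eq_intros)
    moreover have "- (2 * q / (1 - q)) * (exp (- (1 - q) * s) * (- (1 - q))) = 2 * q * exp (- (1 - q) * s)"
      using q by (simp add: divide_simps) (simp add: algebra_simps)
    ultimately show "((\<lambda>s. - (2 * q / (1 - q)) * exp (- (1 - q) * s)) has_real_derivative
        2 * q * exp (- (1 - q) * s)) (at s)"
      by (simp only:)
  qed (use q in simp_all)
  also have "1 + \<dots> = ennreal (1 + 2 * q / (1 - q))"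
    using q by (subst ennreal_plus) simp_all
  also have "1 + 2 * q / (1 - q) = (1 + q) / (1 - q)"
    using q by (simp add: field_simps)
  finally show ?thesis
    by (simp add: add_left_mono)
qed

text \<open>
  The linear and the quadratic noise term are treated jointly. Splitting them by Cauchy and
  Schwarz would double the factor \<open>4 \<sigma>\<^sup>2\<close> of \<open>|v|\<^sup>2\<close>, which is too much for the noise direction of
  \<open>noise_direction_bound\<close>.

  Put \<open>\<tau> = |W|\<^sup>2 / (2 \<sigma>\<^sup>2)\<close>, which has the tail of \<open>exponential_moment_of_tail\<close>, so that the
  quadratic term is \<open>u \<tau>\<close> and the linear term has square at most \<open>B \<tau>\<close>. For small \<open>v\<close> the linear
  term is removed with \<open>exp_add_le_affine_plus_gauss\<close>, using that the noise is centered. For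
  large \<open>v\<close> Young's inequality \<open>v \<bullet> W \<le> B + \<tau> / 4\<close> is good enough, since the factor it costs is
  bounded while \<open>exp B\<close> is to spare.
\<close>

lemma (in prob_space) subgaussian_mgf:
  fixes W :: "'a \<Rightarrow> 'b::euclidean_space"
  assumes [measurable]: "W \<in> borel_measurable M"
    and int: "integrable M W" and centered: "(\<integral>\<omega>. W \<omega> \<partial>M) = 0"
    and tail: "\<And>t. 0 \<le> t \<Longrightarrow> prob {\<omega> \<in> space M. t \<le> norm (W \<omega>)} \<le> 2 * exp (- t\<^sup>2 / (2 * \<sigma>\<^sup>2))"
    and \<sigma>: "0 < \<sigma>" and \<eta>: "0 \<le> \<eta>" "16 * \<eta> * \<sigma>\<^sup>2 \<le> 1"
  shows "(\<integral>\<^sup>+\<omega>. ennreal (exp (v \<bullet> W \<omega> + \<eta> * (norm (W \<omega>))\<^sup>2)) \<partial>M)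
    \<le> ennreal (exp (8 * \<sigma>\<^sup>2 * \<eta> + 4 * \<sigma>\<^sup>2 * (norm v)\<^sup>2))"
proof -
  define \<tau> where "\<tau> \<omega> = (norm (W \<omega>))\<^sup>2 / (2 * \<sigma>\<^sup>2)" for \<omega>
  define u where "u = 2 * \<eta> * \<sigma>\<^sup>2"
  define B where "B = 2 * \<sigma>\<^sup>2 * (norm v)\<^sup>2"
  define q where "q = 3 / 4 * B + 3 / 2 * u"
  have \<tau>_meas [measurable]: "\<tau> \<in> borel_measurable M"
    unfolding \<tau>_def by measurable
  have \<tau>_nonneg: "0 \<le> \<tau> \<omega>" for \<omega>
    by (simp add: \<tau>_def)
  have u: "0 \<le> u" "u \<le> 1 / 8" and B: "0 \<le> B"
    using \<eta> by (simp_all add: u_def B_def)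
  have quad: "\<eta> * (norm (W \<omega>))\<^sup>2 = u * \<tau> \<omega>" for \<omega>
    using \<sigma> by (simp add: \<tau>_def u_def)
  have lin: "(v \<bullet> W \<omega>)\<^sup>2 \<le> B * \<tau> \<omega>" for \<omega>
  proof -
    have "(v \<bullet> W \<omega>)\<^sup>2 \<le> (norm v)\<^sup>2 * (norm (W \<omega>))\<^sup>2"
      using Cauchy_Schwarz_ineq[of v "W \<omega>"] by (simp add: power2_norm_eq_inner)
    also have "\<dots> = B * \<tau> \<omega>"
      using \<sigma> by (simp add: B_def \<tau>_def)
    finally show ?thesis .
  qed
  have tail_\<tau>: "prob {\<omega> \<in> space M. s \<le> \<tau> \<omega>} \<le> 2 * exp (- s)" if "0 \<le> s" for s
  proof -
    have "s \<le> \<tau> \<omega> \<longleftrightarrow> \<sigma> * sqrt (2 * s) \<le> norm (W \<omega>)" for \<omega>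
    proof -
      have "s \<le> \<tau> \<omega> \<longleftrightarrow> (\<sigma> * sqrt (2 * s))\<^sup>2 \<le> (norm (W \<omega>))\<^sup>2"
        using \<sigma> that by (simp add: \<tau>_def field_simps power_mult_distrib)
      also have "\<dots> \<longleftrightarrow> \<sigma> * sqrt (2 * s) \<le> norm (W \<omega>)"
        using \<sigma> that by (simp add: abs_le_square_iff[symmetric])
      finally show ?thesis .
    qed
    then have "prob {\<omega> \<in> space M. s \<le> \<tau> \<omega>} \<le> 2 * exp (- (\<sigma> * sqrt (2 * s))\<^sup>2 / (2 * \<sigma>\<^sup>2))"
      using tail[of "\<sigma> * sqrt (2 * s)"] \<sigma> that by simp
    then show ?thesis
      using \<sigma> that by (simp add: power_mult_distrib)
  qed
  have moment: "(\<integral>\<^sup>+\<omega>. ennreal (exp (p * \<tau> \<omega>)) \<partial>M) \<le> ennreal ((1 + p) / (1 - p))"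
    if "0 \<le> p" "p < 1" for p
    using exponential_moment_of_tail[OF \<tau>_meas \<tau>_nonneg tail_\<tau> that] .
  show ?thesis
  proof (cases "q \<le> 3 / 4")
    case True
    have q: "0 \<le> q"
      using u B by (simp add: q_def)
    have int_exp: "integrable M (\<lambda>\<omega>. exp (q * \<tau> \<omega>))"
    proof (rule integrableI_nonneg)
      show "(\<integral>\<^sup>+\<omega>. ennreal (exp (q * \<tau> \<omega>)) \<partial>M) < \<infinity>"
        using moment[of q] q True by (simp add: order.strict_trans1[OF _ ennreal_less_top])
    qed simp_all
    have int_lin: "integrable M (\<lambda>\<omega>. v \<bullet> W \<omega>)"
      using int by (rule integrable_inner_right)
    have point: "exp (v \<bullet> W \<omega> + \<eta> * (norm (W \<omega>))\<^sup>2) \<le> v \<bullet> W \<omega> + exp (q * \<tau> \<omega>)" for \<omega>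
    proof -
      have "exp (v \<bullet> W \<omega> + u * \<tau> \<omega>) \<le> v \<bullet> W \<omega> + exp (3 / 4 * (v \<bullet> W \<omega>)\<^sup>2 + 3 / 2 * (u * \<tau> \<omega>))"
        using u \<tau>_nonneg by (intro exp_add_le_affine_plus_gauss) simp
      also have "\<dots> \<le> v \<bullet> W \<omega> + exp (q * \<tau> \<omega>)"
        using lin[of \<omega>] by (simp add: q_def algebra_simps)
      finally show ?thesis
        by (simp only: quad)
    qed
    have "(\<integral>\<^sup>+\<omega>. ennreal (exp (v \<bullet> W \<omega> + \<eta> * (norm (W \<omega>))\<^sup>2)) \<partial>M)
      \<le> (\<integral>\<^sup>+\<omega>. ennreal (v \<bullet> W \<omega> + exp (q * \<tau> \<omega>)) \<partial>M)"
      by (intro nn_integral_mono ennreal_leI point)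
    also have "\<dots> = ennreal (\<integral>\<omega>. v \<bullet> W \<omega> + exp (q * \<tau> \<omega>) \<partial>M)"
    proof (rule nn_integral_eq_integral)
      show "AE \<omega> in M. 0 \<le> v \<bullet> W \<omega> + exp (q * \<tau> \<omega>)"
      proof (rule AE_I2)
        show "0 \<le> v \<bullet> W \<omega> + exp (q * \<tau> \<omega>)" for \<omega>
          using point[of \<omega>] exp_ge_zero[of "v \<bullet> W \<omega> + \<eta> * (norm (W \<omega>))\<^sup>2"] by linarith
      qed
    qed (intro Bochner_Integration.integrable_add int_lin int_exp)
    also have "(\<integral>\<omega>. v \<bullet> W \<omega> + exp (q * \<tau> \<omega>) \<partial>M) = (\<integral>\<omega>. exp (q * \<tau> \<omega>) \<partial>M)"
      using Bochner_Integration.integral_add[OF int_lin int_exp] integral_inner_right[of v M W] int centered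
      by simp
    also have "ennreal \<dots> = (\<integral>\<^sup>+\<omega>. ennreal (exp (q * \<tau> \<omega>)) \<partial>M)"
      using int_exp by (intro nn_integral_eq_integral[symmetric]) simp_all
    also have "\<dots> \<le> ennreal ((1 + q) / (1 - q))"
      using q True by (intro moment) simp_all
    also have "\<dots> \<le> ennreal (exp (8 / 3 * q))"
      using q True by (intro ennreal_leI geometric_moment_le_exp)
    also have "8 / 3 * q = 8 * \<sigma>\<^sup>2 * \<eta> + 4 * \<sigma>\<^sup>2 * (norm v)\<^sup>2"
      by (simp add: q_def u_def B_def)
    finally show ?thesis .
  next
    case False
    define p where "p = 1 / 4 + u"
    have p: "0 \<le> p" "p \<le> 3 / 8"
      using u by (simp_all add: p_def)
    have point: "v \<bullet> W \<omega> + \<eta> * (norm (W \<omega>))\<^sup>2 \<le> B + p * \<tau> \<omega>" for \<omega>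
    proof -
      have "B * \<tau> \<omega> \<le> (B + \<tau> \<omega> / 4)\<^sup>2"
        using zero_le_power2[of "B - \<tau> \<omega> / 4"] by (simp add: power2_eq_square algebra_simps)
      then have "v \<bullet> W \<omega> \<le> B + \<tau> \<omega> / 4"
        using lin[of \<omega>] B \<tau>_nonneg[of \<omega>] by - (rule power2_le_imp_le, simp_all)
      then show ?thesis
        by (simp add: quad p_def algebra_simps)
    qed
    have "(\<integral>\<^sup>+\<omega>. ennreal (exp (v \<bullet> W \<omega> + \<eta> * (norm (W \<omega>))\<^sup>2)) \<partial>M)
      \<le> (\<integral>\<^sup>+\<omega>. ennreal (exp B) * ennreal (exp (p * \<tau> \<omega>)) \<partial>M)"
      using point by (intro nn_integral_mono) (simp add: ennreal_mult[symmetric] exp_add[symmetric])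
    also have "\<dots> = ennreal (exp B) * (\<integral>\<^sup>+\<omega>. ennreal (exp (p * \<tau> \<omega>)) \<partial>M)"
      by (rule nn_integral_cmult) measurable
    also have "\<dots> \<le> ennreal (exp B) * ennreal ((1 + p) / (1 - p))"
      using p by (intro mult_left_mono moment) simp_all
    also have "\<dots> \<le> ennreal (exp B) * ennreal (exp (B + 4 * u))"
    proof (intro mult_left_mono ennreal_leI)
      have "(1 + p) / (1 - p) \<le> exp (8 / 3 * p)"
        using p by (intro geometric_moment_le_exp) simp_all
      also have "\<dots> \<le> exp (B + 4 * u)"
        using False u by (simp add: q_def p_def)
      finally show "(1 + p) / (1 - p) \<le> exp (B + 4 * u)" .
    qed simp
    also have "\<dots> = ennreal (exp (8 * \<sigma>\<^sup>2 * \<eta> + 4 * \<sigma>\<^sup>2 * (norm v)\<^sup>2))"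
      by (simp add: B_def u_def ennreal_mult[symmetric] flip: exp_add)
    finally show ?thesis .
  qed
qed

section \<open>Conditioning on the past and risk measures\<close>

text \<open>
  Freezing: the expectation of a function of the noise and of a variable known before it is
  bounded by bounding the expectation over the noise for each fixed value of that variable.
\<close>

lemma (in prob_space) nn_integral_indep_le:
  fixes Z :: "'a \<Rightarrow> 'b::topological_space" and W :: "'a \<Rightarrow> 'c::topological_space"
  assumes indep: "indep_set (sets (vimage_algebra (space M) W borel)) (sets F)"
    and F: "subalgebra M F" and Z: "Z \<in> borel_measurable F"
    and W [measurable]: "W \<in> borel_measurable M"
    and h [measurable]: "h \<in> borel_measurable (borel \<Otimes>\<^sub>M borel)"
    and bound: "\<And>z. (\<integral>\<^sup>+\<omega>. h (z, W \<omega>) \<partial>M) \<le> H z"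
  shows "(\<integral>\<^sup>+\<omega>. h (Z \<omega>, W \<omega>) \<partial>M) \<le> (\<integral>\<^sup>+\<omega>. H (Z \<omega>) \<partial>M)"
proof -
  have ZM [measurable]: "Z \<in> borel_measurable M"
    using measurable_from_subalg[OF F Z] .
  interpret Z: prob_space "distr M borel Z"
    by (rule prob_space_distr) measurable
  interpret W: prob_space "distr M borel W"
    by (rule prob_space_distr) measurable
  have joint: "distr M borel Z \<Otimes>\<^sub>M distr M borel W = distr M (borel \<Otimes>\<^sub>M borel) (\<lambda>\<omega>. (Z \<omega>, W \<omega>))"
  proof (rule pair_measure_eqI)
    fix A B assume "A \<in> sets (distr M borel Z)" "B \<in> sets (distr M borel W)"
    then have A [measurable]: "A \<in> sets borel" and B [measurable]: "B \<in> sets borel"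
      by simp_all
    have "Z -` A \<inter> space M \<in> sets F"
      using measurable_sets[OF Z A] F by (simp add: subalgebra_def)
    moreover have "W -` B \<inter> space M \<in> sets (vimage_algebra (space M) W borel)"
      using B by (rule in_vimage_algebra)
    ultimately have "prob ((W -` B \<inter> space M) \<inter> (Z -` A \<inter> space M))
        = prob (W -` B \<inter> space M) * prob (Z -` A \<inter> space M)"
      by (intro indep_setD[OF indep])
    moreover have "(\<lambda>\<omega>. (Z \<omega>, W \<omega>)) -` (A \<times> B) \<inter> space M = (W -` B \<inter> space M) \<inter> (Z -` A \<inter> space M)"
      by auto
    ultimately show "emeasure (distr M borel Z) A * emeasure (distr M borel W) B
        = emeasure (distr M (borel \<Otimes>\<^sub>M borel) (\<lambda>\<omega>. (Z \<omega>, W \<omega>))) (A \<times> B)"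
      by (simp add: emeasure_distr emeasure_eq_measure ennreal_mult[symmetric] mult.commute)
  qed (simp_all add: Z.sigma_finite_measure_axioms W.sigma_finite_measure_axioms cong: sets_pair_measure_cong)
  have "(\<integral>\<^sup>+\<omega>. h (Z \<omega>, W \<omega>) \<partial>M) = (\<integral>\<^sup>+y. h y \<partial>(distr M borel Z \<Otimes>\<^sub>M distr M borel W))"
    unfolding joint by (subst nn_integral_distr) measurable
  also have "\<dots> = (\<integral>\<^sup>+z. \<integral>\<^sup>+y. h (z, y) \<partial>distr M borel W \<partial>distr M borel Z)"
    by (rule W.nn_integral_fst[symmetric]) simp
  also have "\<dots> = (\<integral>\<^sup>+z. \<integral>\<^sup>+\<omega>. h (z, W \<omega>) \<partial>M \<partial>distr M borel Z)"
    by (intro nn_integral_cong nn_integral_distr) measurable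
  also have "\<dots> = (\<integral>\<^sup>+\<omega>'. \<integral>\<^sup>+\<omega>. h (Z \<omega>', W \<omega>) \<partial>M \<partial>M)"
    by (rule nn_integral_distr) measurable
  also have "\<dots> \<le> (\<integral>\<^sup>+\<omega>'. H (Z \<omega>') \<partial>M)"
    by (intro nn_integral_mono bound)
  finally show ?thesis .
qed

lemma space_natural_filtration [simp]: "space (natural_filtration M x k) = space M"
  by (simp add: natural_filtration_def space_measure_of_conv)

lemma sets_natural_filtration:
  "sets (natural_filtration M x k)
    = sigma_sets (space M) {x i -` A \<inter> space M | i A. i \<le> k \<and> A \<in> sets borel}"
  unfolding natural_filtration_def by (rule sets_measure_of) auto

lemma measurable_natural_filtration:
  assumes "i \<le> k"
  shows "x i \<in> borel_measurable (natural_filtration M x k)"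
proof (rule measurableI)
  fix A :: "'b set" assume "A \<in> sets borel"
  then have "x i -` A \<inter> space M \<in> {x i -` A \<inter> space M | i A. i \<le> k \<and> A \<in> sets borel}"
    using assms by blast
  then show "x i -` A \<inter> space (natural_filtration M x k) \<in> sets (natural_filtration M x k)"
    unfolding space_natural_filtration sets_natural_filtration by (rule sigma_sets.Basic)
qed simp

lemma subalgebra_natural_filtration:
  assumes "\<And>i. x i \<in> borel_measurable M"
  shows "subalgebra M (natural_filtration M x k)"
proof -
  have "{x i -` A \<inter> space M | i A. i \<le> k \<and> A \<in> sets borel} \<subseteq> sets M"
    using assms by (auto intro: measurable_sets)
  then have "sets (natural_filtration M x k) \<subseteq> sets M"
    unfolding sets_natural_filtration by (rule sets.sigma_sets_subset)
  then show ?thesis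
    by (simp add: subalgebra_def)
qed

context prob_space
begin

text \<open>
  The tower property: integrating a conditional expectation removes the conditioning.
\<close>

lemma subgaussian_noise_unconditional:
  fixes w :: "nat \<Rightarrow> 'a \<Rightarrow> real ^ 'd"
  assumes noise: "subgaussian_noise M F \<sigma> w" and F: "subalgebra M (F k)"
  shows "(\<integral>\<omega>. w (Suc k) \<omega> \<partial>M) = 0"
    and "0 \<le> t \<Longrightarrow> prob {\<omega> \<in> space M. t \<le> norm (w (Suc k) \<omega>)} \<le> 2 * exp (- t\<^sup>2 / (2 * \<sigma>\<^sup>2))"
proof -
  interpret finite_measure_subalgebra M "F k"
    by unfold_locales (rule F)
  have meas [measurable]: "w (Suc k) \<in> borel_measurable M" and int: "integrable M (w (Suc k))"
    and mean: "\<And>i. AE \<omega> in M. real_cond_exp M (F k) (\<lambda>\<omega>. w (Suc k) \<omega> $ i) \<omega> = 0"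
    and tail: "\<And>t. 0 \<le> t \<Longrightarrow> AE \<omega> in M.
       real_cond_exp M (F k) (indicator {\<omega> \<in> space M. t \<le> norm (w (Suc k) \<omega>)}) \<omega>
         \<le> 2 * exp (- t\<^sup>2 / (2 * \<sigma>\<^sup>2))"
    using noise by (auto simp: subgaussian_noise_def)
  have "(\<integral>\<omega>. w (Suc k) \<omega> \<partial>M) $ i = 0" for i
  proof -
    have inti: "integrable M (\<lambda>\<omega>. w (Suc k) \<omega> $ i)"
      by (rule integrable_bounded_linear[OF bounded_linear_vec_nth int])
    have "(\<integral>\<omega>. w (Suc k) \<omega> \<partial>M) $ i = (\<integral>\<omega>. w (Suc k) \<omega> $ i \<partial>M)"
      by (rule integral_bounded_linear[OF bounded_linear_vec_nth int, symmetric])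
    also have "\<dots> = (\<integral>\<omega>. real_cond_exp M (F k) (\<lambda>\<omega>. w (Suc k) \<omega> $ i) \<omega> \<partial>M)"
      by (rule real_cond_exp_int(2)[OF inti, symmetric])
    also have "\<dots> = (\<integral>\<omega>. 0 \<partial>M)"
      by (rule integral_cong_AE) (use mean in auto)
    finally show ?thesis
      by simp
  qed
  then show "(\<integral>\<omega>. w (Suc k) \<omega> \<partial>M) = 0"
    by (simp add: vec_eq_iff)
  show "prob {\<omega> \<in> space M. t \<le> norm (w (Suc k) \<omega>)} \<le> 2 * exp (- t\<^sup>2 / (2 * \<sigma>\<^sup>2))" if "0 \<le> t"
  proof -
    let ?E = "{\<omega> \<in> space M. t \<le> norm (w (Suc k) \<omega>)}"
    have intE: "integrable M (indicator ?E :: 'a \<Rightarrow> real)"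
      by (rule integrable_real_indicator) (simp_all add: emeasure_eq_measure)
    have "prob ?E = (\<integral>\<omega>. real_cond_exp M (F k) (indicator ?E) \<omega> \<partial>M)"
      unfolding real_cond_exp_int(2)[OF intE] by simp
    also have "\<dots> \<le> (\<integral>\<omega>. 2 * exp (- t\<^sup>2 / (2 * \<sigma>\<^sup>2)) \<partial>M)"
      by (rule integral_mono_AE[OF real_cond_exp_int(1)[OF intE] _ tail[OF that]]) simp
    finally show ?thesis
      by (simp add: prob_space)
  qed
qed

text \<open>
  Nonnegativity of \<open>X\<close> makes the expectation at least \<open>1\<close>, so that its logarithm is monotone.
\<close>

lemma entropic_risk_le:
  assumes [measurable]: "X \<in> borel_measurable M" and nonneg: "\<And>\<omega>. 0 \<le> X \<omega>"
    and pos: "0 < t" "0 < \<sigma>"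
    and bound: "(\<integral>\<^sup>+\<omega>. ennreal (exp (t / (2 * \<sigma>\<^sup>2) * X \<omega>)) \<partial>M) \<le> ennreal (exp (t / (2 * \<sigma>\<^sup>2) * R))"
  shows "entropic_risk M \<sigma> X t \<le> ereal R"
proof -
  let ?e = "\<lambda>\<omega>. exp (t / (2 * \<sigma>\<^sup>2) * X \<omega>)"
  have int: "integrable M ?e"
  proof (rule integrableI_nonneg)
    show "(\<integral>\<^sup>+\<omega>. ennreal (?e \<omega>) \<partial>M) < \<infinity>"
      using order.strict_trans1[OF bound ennreal_less_top] by simp
  qed simp_all
  then have "ennreal (\<integral>\<omega>. ?e \<omega> \<partial>M) \<le> ennreal (exp (t / (2 * \<sigma>\<^sup>2) * R))"
    using bound by (simp add: nn_integral_eq_integral)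
  then have le: "(\<integral>\<omega>. ?e \<omega> \<partial>M) \<le> exp (t / (2 * \<sigma>\<^sup>2) * R)"
    by (simp add: ennreal_le_iff)
  have "(\<integral>\<omega>. 1 \<partial>M) \<le> (\<integral>\<omega>. ?e \<omega> \<partial>M)"
    using int nonneg pos by (intro integral_mono) simp_all
  then have "1 \<le> (\<integral>\<omega>. ?e \<omega> \<partial>M)"
    by (simp add: prob_space)
  then have "ln (\<integral>\<omega>. ?e \<omega> \<partial>M) \<le> ln (exp (t / (2 * \<sigma>\<^sup>2) * R))"
    using le by (subst ln_le_cancel_iff) simp_all
  then have "2 * \<sigma>\<^sup>2 / t * ln (\<integral>\<omega>. ?e \<omega> \<partial>M) \<le> 2 * \<sigma>\<^sup>2 / t * (t / (2 * \<sigma>\<^sup>2) * R)"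
    using pos by (intro mult_left_mono) simp_all
  also have "\<dots> = R"
    using pos by simp
  finally show ?thesis
    using int by (simp add: entropic_risk_def)
qed

end

lemma EVaR_le:
  assumes "0 < t" "entropic_risk M \<sigma> X t \<le> ereal R"
  shows "EVaR M \<sigma> \<zeta> X \<le> ereal (R + 2 * \<sigma>\<^sup>2 / t * ln (1 / \<zeta>))"
proof -
  have "entropic_risk M \<sigma> X t + ereal (2 * \<sigma>\<^sup>2 / t * ln (1 / \<zeta>))
      \<le> ereal R + ereal (2 * \<sigma>\<^sup>2 / t * ln (1 / \<zeta>))"
    using assms(2) by (rule add_right_mono)
  then show ?thesis
    unfolding EVaR_def plus_ereal.simps(1) using assms(1) by (intro INF_lower2[of t]) simp_all
qed

section \<open>The recursion for exponential moments\<close>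

context gmm_parameters
begin

lemma gmm_state_Suc:
  "gmm_state f \<alpha> \<beta> \<gamma> x0 xm w (Suc k) =
    (let z = gmm_state f \<alpha> \<beta> \<gamma> x0 xm w k
     in (noiseless_step f (fst z) (snd z) - \<alpha> *\<^sub>R w (Suc k), fst z))"
  by (simp add: noiseless_step_def Let_def case_prod_beta algebra_simps)

lemma continuous_noiseless_step:
  fixes f :: "real ^ 'd \<Rightarrow> real"
  assumes "smooth L f"
  shows "continuous_on UNIV (\<lambda>z. noiseless_step f (fst z) (snd z))"
  unfolding noiseless_step_def
  by (intro continuous_intros continuous_on_compose2[OF continuous_grad[OF assms]]) auto

lemma continuous_lyapunov:
  fixes f :: "real ^ 'd \<Rightarrow> real" and g h :: "'b::topological_space \<Rightarrow> real ^ 'd"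
  assumes "smooth L f" "continuous_on UNIV g" "continuous_on UNIV h"
  shows "continuous_on UNIV (\<lambda>y. V f xs (g y) (h y))"
proof -
  have "continuous_on UNIV f"
    using assms(1) by (auto simp: smooth_def intro!: continuous_at_imp_continuous_on
        differentiable_imp_continuous_within)
  then have "continuous_on UNIV (\<lambda>y. f (g y))"
    using assms(2) by (rule continuous_on_compose2) simp
  then show ?thesis
    unfolding lyapunov_eq lyapunov_vec_eq by (intro continuous_intros assms)
qed

lemma lyapunov_ge_gap:
  fixes f :: "real ^ 'd \<Rightarrow> real"
  shows "f x - f xs \<le> V f xs x x'"
  by (simp add: lyapunov_eq)

text \<open>
  In the exponent the noise contributes a linear term with \<open>|v|\<^sup>2 = c\<^sup>2 \<alpha>\<^sup>2 |G|\<^sup>2\<close> and a quadratic one.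
  By \<open>subgaussian_mgf\<close> the quadratic term costs a constant, while the linear one costs a multiple
  of the Lyapunov function, since \<open>|G|\<^sup>2 \<le> 16 v V\<close>. The latter worsens the contraction factor by
  \<open>32 \<alpha>\<^sup>2 v t\<close>, where \<open>t\<close> bounds the risk parameter \<open>2 \<sigma>\<^sup>2 c\<close>.
\<close>

lemma lyapunov_exp_moment_step:
  fixes f :: "real ^ 'd \<Rightarrow> real" and W :: "'a \<Rightarrow> real ^ 'd"
  assumes M: "prob_space M" and W: "W \<in> borel_measurable M" "integrable M W" "(\<integral>\<omega>. W \<omega> \<partial>M) = 0"
    and tail: "\<And>t. 0 \<le> t \<Longrightarrow>
      measure M {\<omega> \<in> space M. t \<le> norm (W \<omega>)} \<le> 2 * exp (- t\<^sup>2 / (2 * \<sigma>\<^sup>2))"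
    and \<sigma>: "0 < \<sigma>" and sc: "strongly_convex \<mu> f" and sm: "smooth L f" and min: "\<And>y. f xs \<le> f y"
    and v_ge: "\<theta> / (2 * \<alpha>) * (1 - r) \<le> v"
    and t: "4 * \<alpha>\<^sup>2 * (L + 2 * (\<theta> / (2 * \<alpha>))) * t \<le> 1"
    and c: "0 \<le> c" "2 * \<sigma>\<^sup>2 * c \<le> t"
  shows "(\<integral>\<^sup>+\<omega>. ennreal (exp (c * V f xs (noiseless_step f x x' - \<alpha> *\<^sub>R W \<omega>) x)) \<partial>M)
    \<le> ennreal (exp (c * (4 * \<sigma>\<^sup>2 * \<alpha>\<^sup>2 * (L + 2 * (\<theta> / (2 * \<alpha>)))
        + ((1 - r) + 32 * \<alpha>\<^sup>2 * v * t) * V f xs x x')))"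
proof -
  interpret prob_space M
    by (rule M)
  define l where "l = \<theta> / (2 * \<alpha>)"
  define x1 where "x1 = noiseless_step f x x'"
  define G where "G = grad f x1 + (2 * p) *\<^sub>R lyapunov_vec \<mu> \<theta> \<alpha> (x1 - xs) (x - xs)"
  define \<eta> where "\<eta> = c * (\<alpha>\<^sup>2 * (L + 2 * l) / 2)"
  let ?V = "V f xs x x'"
  have l: "0 < l" and L: "0 < L"
    using theta_pos alpha_pos mu_pos mu_less_L by (simp_all add: l_def)
  have V: "0 \<le> ?V"
    using lyapunov_ge_gap[of f x xs x'] min[of x] by linarith
  have contr: "V f xs x1 x \<le> (1 - r) * ?V"
    unfolding x1_def by (rule lyapunov_contraction[OF sc sm])
  have point: "c * V f xs (x1 - \<alpha> *\<^sub>R W \<omega>) x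
      \<le> c * (1 - r) * ?V + ((- (c * \<alpha>)) *\<^sub>R G \<bullet> W \<omega> + \<eta> * (norm (W \<omega>))\<^sup>2)" for \<omega>
  proof -
    have "V f xs (x1 - \<alpha> *\<^sub>R W \<omega>) x
        \<le> (1 - r) * ?V - \<alpha> * (G \<bullet> W \<omega>) + \<alpha>\<^sup>2 * (L + 2 * l) / 2 * (norm (W \<omega>))\<^sup>2"
      using lyapunov_noise_expansion[OF sm, of xs x1 "W \<omega>" x] contr by (simp add: G_def l_def)
    then have "c * V f xs (x1 - \<alpha> *\<^sub>R W \<omega>) x
        \<le> c * ((1 - r) * ?V - \<alpha> * (G \<bullet> W \<omega>) + \<alpha>\<^sup>2 * (L + 2 * l) / 2 * (norm (W \<omega>))\<^sup>2)"
      using c by (rule_tac mult_left_mono)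
    then show ?thesis
      by (simp add: \<eta>_def algebra_simps)
  qed
  have \<eta>: "0 \<le> \<eta>"
    using c l L by (simp add: \<eta>_def)
  have \<eta>_small: "16 * \<eta> * \<sigma>\<^sup>2 \<le> 1"
  proof -
    have "16 * \<eta> * \<sigma>\<^sup>2 = 4 * \<alpha>\<^sup>2 * (L + 2 * l) * (2 * \<sigma>\<^sup>2 * c)"
      by (simp add: \<eta>_def)
    also have "\<dots> \<le> 4 * \<alpha>\<^sup>2 * (L + 2 * l) * t"
      using c l L by (intro mult_left_mono) simp_all
    also have "\<dots> \<le> 1"
      using t unfolding l_def .
    finally show ?thesis .
  qed
  have G: "(norm G)\<^sup>2 \<le> 16 * v * ?V"
  proof -
    have "(norm G)\<^sup>2 \<le> (2 * L + 4 * l) * V f xs x1 x"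
      unfolding G_def l_def by (rule noise_direction_bound[OF sm min])
    also have "\<dots> \<le> (2 * L + 4 * l) * ((1 - r) * ?V)"
      using contr l L by (intro mult_left_mono) simp_all
    also have "\<dots> \<le> (16 * l) * ((1 - r) * ?V)"
    proof (rule mult_right_mono)
      \<comment> \<open>This is the bound \<open>\<alpha> L \<le> 3 \<theta>\<close>.\<close>
      have "L \<le> 6 * l"
        using step_le alpha_pos by (simp add: l_def field_simps)
      then show "2 * L + 4 * l \<le> 16 * l"
        by simp
    qed (use V r_less_1 in simp)
    also have "\<dots> = 16 * (l * (1 - r)) * ?V"
      by simp
    also have "\<dots> \<le> 16 * v * ?V"
      using v_ge V by (intro mult_right_mono) (simp_all add: l_def)
    finally show ?thesis .
  qed
  have v: "0 \<le> v"
    using mult_nonneg_nonneg[of l "1 - r"] v_ge l r_less_1 unfolding l_def by linarith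
  have "4 * \<sigma>\<^sup>2 * (norm ((- (c * \<alpha>)) *\<^sub>R G))\<^sup>2 = 2 * c * \<alpha>\<^sup>2 * (2 * \<sigma>\<^sup>2 * c) * (norm G)\<^sup>2"
    by (simp add: power_mult_distrib power2_eq_square)
  also have "\<dots> \<le> 2 * c * \<alpha>\<^sup>2 * t * (16 * v * ?V)"
    using c G v V \<sigma> by (intro mult_mono) (auto intro!: mult_nonneg_nonneg order_trans[OF _ c(2)])
  finally have exponent: "4 * \<sigma>\<^sup>2 * (norm ((- (c * \<alpha>)) *\<^sub>R G))\<^sup>2 \<le> c * (32 * \<alpha>\<^sup>2 * v * t * ?V)"
    by (simp add: mult_ac)
  have "(\<integral>\<^sup>+\<omega>. ennreal (exp (c * V f xs (x1 - \<alpha> *\<^sub>R W \<omega>) x)) \<partial>M)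
    \<le> (\<integral>\<^sup>+\<omega>. ennreal (exp (c * (1 - r) * ?V)) *
        ennreal (exp ((- (c * \<alpha>)) *\<^sub>R G \<bullet> W \<omega> + \<eta> * (norm (W \<omega>))\<^sup>2)) \<partial>M)"
    unfolding ennreal_mult[OF exp_ge_zero exp_ge_zero, symmetric] exp_add[symmetric]
    by (intro nn_integral_mono ennreal_leI) (simp only: exp_le_cancel_iff point)
  also have "\<dots> = ennreal (exp (c * (1 - r) * ?V)) *
      (\<integral>\<^sup>+\<omega>. ennreal (exp ((- (c * \<alpha>)) *\<^sub>R G \<bullet> W \<omega> + \<eta> * (norm (W \<omega>))\<^sup>2)) \<partial>M)"
    using W(1) by (intro nn_integral_cmult) simp
  also have "\<dots> \<le> ennreal (exp (c * (1 - r) * ?V)) *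
      ennreal (exp (8 * \<sigma>\<^sup>2 * \<eta> + 4 * \<sigma>\<^sup>2 * (norm ((- (c * \<alpha>)) *\<^sub>R G))\<^sup>2))"
    by (intro mult_left_mono subgaussian_mgf[OF W tail \<sigma> \<eta> \<eta>_small]) simp_all
  also have "\<dots> \<le> ennreal (exp (c * (4 * \<sigma>\<^sup>2 * \<alpha>\<^sup>2 * (L + 2 * l) + ((1 - r) + 32 * \<alpha>\<^sup>2 * v * t) * ?V)))"
    unfolding ennreal_mult[OF exp_ge_zero exp_ge_zero, symmetric] exp_add[symmetric]
  proof (intro ennreal_leI, unfold exp_le_cancel_iff)
    have "8 * \<sigma>\<^sup>2 * \<eta> = c * (4 * \<sigma>\<^sup>2 * \<alpha>\<^sup>2 * (L + 2 * l))"
      by (simp add: \<eta>_def)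
    with exponent show "c * (1 - r) * ?V + (8 * \<sigma>\<^sup>2 * \<eta> + 4 * \<sigma>\<^sup>2 * (norm ((- (c * \<alpha>)) *\<^sub>R G))\<^sup>2)
      \<le> c * (4 * \<sigma>\<^sup>2 * \<alpha>\<^sup>2 * (L + 2 * l) + ((1 - r) + 32 * \<alpha>\<^sup>2 * v * t) * ?V)"
      by (simp add: algebra_simps)
  qed
  finally show ?thesis
    by (simp add: x1_def l_def)
qed

text \<open>
  Each step replaces \<open>c\<close> by \<open>c A \<le> c\<close>, so the induction has to range over all smaller \<open>c\<close>;
  \<open>n / (1 - A)\<close> is the fixed point of the recursion for the accumulated noise.
\<close>

lemma lyapunov_exp_moment:
  fixes f :: "real ^ 'd \<Rightarrow> real" and w x :: "nat \<Rightarrow> 'a \<Rightarrow> real ^ 'd"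
  assumes M: "prob_space M" and x: "x = gmm_iterate f \<alpha> \<beta> \<gamma> x0 xm w"
    and noise: "subgaussian_noise M (natural_filtration M x) \<sigma> w"
    and \<sigma>: "0 < \<sigma>" and sc: "strongly_convex \<mu> f" and sm: "smooth L f" and min: "\<And>y. f xs \<le> f y"
    and v_ge: "\<theta> / (2 * \<alpha>) * (1 - r) \<le> v"
    and t: "0 \<le> t" "4 * \<alpha>\<^sup>2 * (L + 2 * (\<theta> / (2 * \<alpha>))) * t \<le> 1"
    and A: "A = (1 - r) + 32 * \<alpha>\<^sup>2 * v * t" "A < 1"
    and n: "n = 4 * \<sigma>\<^sup>2 * \<alpha>\<^sup>2 * (L + 2 * (\<theta> / (2 * \<alpha>)))"
    and c: "0 \<le> c" "2 * \<sigma>\<^sup>2 * c \<le> t"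
  shows "x k \<in> borel_measurable M"
    and "(\<integral>\<^sup>+\<omega>. ennreal (exp (c * (f (x k \<omega>) - f xs))) \<partial>M)
      \<le> ennreal (exp (c * (n / (1 - A) + A ^ k * V f xs x0 xm)))"
proof -
  interpret prob_space M
    by (rule M)
  define Z where "Z k \<omega> = gmm_state f \<alpha> \<beta> \<gamma> x0 xm (\<lambda>j. w j \<omega>) k" for k \<omega>
  have xZ: "x k = (\<lambda>\<omega>. fst (Z k \<omega>))" for k
    by (simp add: x Z_def gmm_iterate_def[abs_def])
  have Z0: "Z 0 \<omega> = (x0, xm)" for \<omega>
    by (simp add: Z_def)
  have Z_Suc: "Z (Suc k) = (\<lambda>\<omega>. (noiseless_step f (fst (Z k \<omega>)) (snd (Z k \<omega>)) - \<alpha> *\<^sub>R w (Suc k) \<omega>,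
      fst (Z k \<omega>)))" for k
    by (simp add: Z_def[abs_def] gmm_state_Suc Let_def del: gmm_state.simps)
  have w: "w (Suc k) \<in> borel_measurable M" "integrable M (w (Suc k))"
    and indep: "indep_set (sets (vimage_algebra (space M) (w (Suc k)) borel))
      (sets (natural_filtration M x k))" for k
    using noise by (auto simp: subgaussian_noise_def)
  have ZM: "Z k \<in> borel_measurable M" for k
  proof (induction k)
    case 0
    then show ?case
      unfolding Z0[abs_def] by simp
  next
    case (Suc k)
    have "(\<lambda>\<omega>. noiseless_step f (fst (Z k \<omega>)) (snd (Z k \<omega>))) \<in> borel_measurable M"
      by (rule borel_measurable_continuous_on[OF continuous_noiseless_step[OF sm] Suc])
    moreover have "(\<lambda>\<omega>. fst (Z k \<omega>)) \<in> borel_measurable M"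
      by (rule borel_measurable_continuous_on[OF _ Suc]) (intro continuous_intros)
    ultimately show ?case
      unfolding Z_Suc using w(1)[of k] by (intro borel_measurable_Pair) simp_all
  qed
  have xM: "x k \<in> borel_measurable M" for k
    unfolding xZ by (rule borel_measurable_continuous_on[OF _ ZM]) (intro continuous_intros)
  then show "x k \<in> borel_measurable M" .
  have F: "subalgebra M (natural_filtration M x k)" for k
    by (rule subalgebra_natural_filtration[OF xM])
  \<comment> \<open>The state is known at time \<open>k\<close>: it consists of two iterates, or of constants for \<open>k = 0\<close>.\<close>
  have ZF: "Z k \<in> borel_measurable (natural_filtration M x k)" for k
  proof (cases k)
    case 0
    then show ?thesis
      unfolding 0 Z0[abs_def] by simp
  next
    case (Suc j)
    have "Z (Suc j) = (\<lambda>\<omega>. (x (Suc j) \<omega>, x j \<omega>))"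
      by (simp add: xZ Z_Suc)
    then show ?thesis
      unfolding Suc by (auto intro!: borel_measurable_Pair measurable_natural_filtration)
  qed
  have A0: "0 \<le> A"
  proof -
    have "0 \<le> \<theta> / (2 * \<alpha>) * (1 - r)"
      using theta_pos alpha_pos r_less_1 by simp
    then show ?thesis
      unfolding A(1) using v_ge t(1) r_less_1 by simp
  qed
  have n0: "0 \<le> n"
    using theta_pos alpha_pos mu_pos mu_less_L by (simp add: n)
  let ?VZ = "\<lambda>z. V f xs (fst z) (snd z)"
  have moment: "(\<integral>\<^sup>+\<omega>. ennreal (exp (c * ?VZ (Z k \<omega>))) \<partial>M)
      \<le> ennreal (exp (c * (n / (1 - A) + A ^ k * V f xs x0 xm)))"
    if "0 \<le> c" "2 * \<sigma>\<^sup>2 * c \<le> t" for c k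
    using that
  proof (induction k arbitrary: c)
    case 0
    have "c * V f xs x0 xm \<le> c * (n / (1 - A) + V f xs x0 xm)"
      using 0 n0 A(2) by (intro mult_left_mono) simp_all
    then show ?case
      by (simp add: Z0 emeasure_space_1 ennreal_leI)
  next
    case (Suc k)
    let ?h = "\<lambda>y. ennreal (exp (c * V f xs
        (noiseless_step f (fst (fst y)) (snd (fst y)) - \<alpha> *\<^sub>R snd y) (fst (fst y))))"
    have "continuous_on UNIV (\<lambda>y :: ((real ^ 'd) \<times> (real ^ 'd)) \<times> (real ^ 'd).
        V f xs (noiseless_step f (fst (fst y)) (snd (fst y)) - \<alpha> *\<^sub>R snd y) (fst (fst y)))"
      by (intro continuous_lyapunov sm continuous_intros
          continuous_on_compose2[OF continuous_noiseless_step[OF sm], of _ fst]) auto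
    then have h: "?h \<in> borel_measurable (borel \<Otimes>\<^sub>M borel)"
      unfolding borel_prod by (intro measurable_compose[OF _ measurable_ennreal]
          borel_measurable_continuous_onI continuous_intros)
    have step: "(\<integral>\<^sup>+\<omega>. ?h (z, w (Suc k) \<omega>) \<partial>M) \<le> ennreal (exp (c * (n + A * ?VZ z)))" for z
      using lyapunov_exp_moment_step[OF M w subgaussian_noise_unconditional[OF noise F] \<sigma> sc sm min v_ge
          t(2) Suc.prems, of "fst z" "snd z"]
      by (simp only: fst_conv snd_conv n A(1))
    have "(\<integral>\<^sup>+\<omega>. ennreal (exp (c * ?VZ (Z (Suc k) \<omega>))) \<partial>M) = (\<integral>\<^sup>+\<omega>. ?h (Z k \<omega>, w (Suc k) \<omega>) \<partial>M)"
      by (simp add: Z_Suc)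
    also have "\<dots> \<le> (\<integral>\<^sup>+\<omega>. ennreal (exp (c * (n + A * ?VZ (Z k \<omega>)))) \<partial>M)"
      by (rule nn_integral_indep_le[OF indep F ZF w(1) h step])
    also have "\<dots> = (\<integral>\<^sup>+\<omega>. ennreal (exp (c * n)) * ennreal (exp (c * A * ?VZ (Z k \<omega>))) \<partial>M)"
      by (simp add: ennreal_mult[symmetric] algebra_simps flip: exp_add)
    also have "\<dots> = ennreal (exp (c * n)) * (\<integral>\<^sup>+\<omega>. ennreal (exp (c * A * ?VZ (Z k \<omega>))) \<partial>M)"
    proof (rule nn_integral_cmult)
      have "(\<lambda>\<omega>. ?VZ (Z k \<omega>)) \<in> borel_measurable M"
        by (rule borel_measurable_continuous_on[OF _ ZM]) (intro continuous_lyapunov sm continuous_intros)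
      then show "(\<lambda>\<omega>. ennreal (exp (c * A * ?VZ (Z k \<omega>)))) \<in> borel_measurable M"
        by simp
    qed
    also have "\<dots> \<le> ennreal (exp (c * n)) * ennreal (exp (c * A * (n / (1 - A) + A ^ k * V f xs x0 xm)))"
    proof (intro mult_left_mono Suc.IH)
      have "c * A \<le> c"
        using Suc.prems A(2) by (simp add: mult_left_le)
      then have "2 * \<sigma>\<^sup>2 * (c * A) \<le> 2 * \<sigma>\<^sup>2 * c"
        by (intro mult_left_mono) simp_all
      with Suc.prems show "2 * \<sigma>\<^sup>2 * (c * A) \<le> t"
        by linarith
    qed (use Suc.prems A0 in simp_all)
    also have "\<dots> = ennreal (exp (c * (n / (1 - A) + A ^ Suc k * V f xs x0 xm)))"
    proof -
      have "n + A * (n / (1 - A)) = n / (1 - A)"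
        using A(2) by (simp add: field_simps)
      then have "c * n + c * A * (n / (1 - A) + A ^ k * V f xs x0 xm)
          = c * (n / (1 - A) + A ^ Suc k * V f xs x0 xm)"
        by (metis (no_types, lifting) distrib_left mult.assoc power_Suc add.assoc)
      then show ?thesis
        by (simp only: ennreal_mult[OF exp_ge_zero exp_ge_zero, symmetric] exp_add[symmetric])
    qed
    finally show ?case .
  qed
  have "(\<integral>\<^sup>+\<omega>. ennreal (exp (c * (f (x k \<omega>) - f xs))) \<partial>M) \<le> (\<integral>\<^sup>+\<omega>. ennreal (exp (c * ?VZ (Z k \<omega>))) \<partial>M)"
    unfolding xZ
    by (intro nn_integral_mono ennreal_leI)
      (simp only: exp_le_cancel_iff mult_left_mono[OF lyapunov_ge_gap c(1)])
  also have "\<dots> \<le> ennreal (exp (c * (n / (1 - A) + A ^ k * V f xs x0 xm)))"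
    by (rule moment[OF c])
  finally show "(\<integral>\<^sup>+\<omega>. ennreal (exp (c * (f (x k \<omega>) - f xs))) \<partial>M)
      \<le> ennreal (exp (c * (n / (1 - A) + A ^ k * V f xs x0 xm)))" .
qed

end

text \<open>
  The function \<open>a / (D - b t) + 2 l / t\<close> has its minimum where
  \<open>sqrt (a b) t = sqrt (2 l) (D - b t)\<close>, and the value there is the stated one. The hypothesis
  \<open>le\<close> says exactly that this point is at most \<open>T\<close>.
\<close>

lemma risk_bound_minimiser:
  fixes a b D l T :: real
  assumes pos: "0 < a" "0 < b" "0 < D" "0 < l" and T: "0 < T" "b * T < D"
    and le: "2 * l * (D - b * T)\<^sup>2 \<le> a * b * T\<^sup>2"
  obtains t where "0 < t" "t \<le> T" "a / (D - b * t) + 2 * l / t = (sqrt a + sqrt (2 * l * b))\<^sup>2 / D"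
proof -
  define S u where "S = sqrt (a * b)" and "u = sqrt (2 * l)"
  define t where "t = D * u / (S + b * u)"
  have S: "0 < S" "S\<^sup>2 = a * b" and u: "0 < u" "u\<^sup>2 = 2 * l"
    using pos by (simp_all add: S_def u_def)
  have den: "0 < S + b * u"
    using S u pos by (simp add: add_pos_pos)
  have t: "0 < t"
    using pos u den by (simp add: t_def)
  moreover have "t \<le> T"
  proof -
    have "(u * (D - b * T))\<^sup>2 \<le> (S * T)\<^sup>2"
      using le by (simp add: power_mult_distrib S u)
    then have "u * (D - b * T) \<le> S * T"
      using S T by - (rule power2_le_imp_le, simp_all)
    then show ?thesis
      using den by (simp add: t_def pos_divide_le_eq algebra_simps)
  qed
  moreover have "a / (D - b * t) + 2 * l / t = (sqrt a + sqrt (2 * l * b))\<^sup>2 / D"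
  proof -
    have "D - b * t = D * S / (S + b * u)"
      using den by (simp add: t_def field_simps)
    then have "a / (D - b * t) = a / S * (S + b * u) / D"
      by simp
    also have "a / S = S / b"
      using S pos by (simp add: field_simps power2_eq_square)
    finally have one: "a / (D - b * t) = (S / b) * (S + b * u) / D" .
    have two: "2 * l / t = u * (S + b * u) / D"
      unfolding u(2)[symmetric] t_def using u(1) by (simp add: power2_eq_square)
    have "(S / b) * (S + b * u) + u * (S + b * u) = S\<^sup>2 / b + 2 * S * u + u\<^sup>2 * b"
      using pos by (simp add: field_simps power2_eq_square)
    also have "\<dots> = a + 2 * S * u + 2 * l * b"
      using pos by (simp add: S u)
    also have "S * u = sqrt a * sqrt (2 * l * b)"
      by (simp add: S_def u_def real_sqrt_mult)
    then have "a + 2 * S * u + 2 * l * b = (sqrt a + sqrt (2 * l * b))\<^sup>2"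
      using pos by (simp add: power2_sum)
    finally show ?thesis
      unfolding one two by (simp only: add_divide_distrib[symmetric])
  qed
  ultimately show thesis
    by (rule that)
qed

section \<open>Value at risk of the function gap\<close>

theorem theorem5:
  fixes f :: "real ^ 'd \<Rightarrow> real"
    and M :: "'a measure"
    and w x :: "nat \<Rightarrow> 'a \<Rightarrow> real ^ 'd"
    and x0 xm xs :: "real ^ 'd"
    and \<mu> L \<sigma> vartheta \<psi> \<alpha> \<beta> \<gamma> \<phi> \<zeta> :: real
    and rho_sq lambda_P v_hat theta_u theta_phi t_hat rho_hat :: real
    and star :: bool
  assumes "0 < \<mu>" and "\<mu> < L"
    and "strongly_convex \<mu> f" and "smooth L f"
    and "\<forall>y. y \<noteq> xs \<longrightarrow> f xs < f y"
    and "(vartheta, \<psi>) \<in> S_zero \<union> S_c \<mu> L"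
    and "(vartheta, \<psi>) \<in> S_c \<mu> L \<Longrightarrow> \<alpha> = (1 - vartheta) / (L * (1 - \<psi>))"
    and "(vartheta, \<psi>) \<in> S_zero \<Longrightarrow> 0 < \<alpha> \<and> \<alpha> \<le> 1 / L"
    and "\<beta> = (1 - sqrt (vartheta * \<alpha> * \<mu>)) / (1 - \<alpha> * \<psi> * \<mu>)
              * (1 - sqrt (\<alpha> * \<mu> / vartheta))"
    and "\<gamma> = \<psi> * \<beta>"
    and "prob_space M" and "0 < \<sigma>"
    and "x = gmm_iterate f \<alpha> \<beta> \<gamma> x0 xm w"
    and "subgaussian_noise M (natural_filtration M x) \<sigma> w"
    and "0 < \<phi>" and "\<phi> < 1" and "0 < \<zeta>" and "\<zeta> < 1"
    and "rho_sq = 1 - sqrt (vartheta * \<alpha> * \<mu>)"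
    and "lambda_P = vartheta / (2 * \<alpha>)"
    and "v_hat = 2 * L\<^sup>2 / \<mu> * (2 * (\<beta> - \<gamma>)\<^sup>2 + (1 - \<alpha> * L)\<^sup>2 * (1 + 2 * \<gamma> + 2 * \<gamma>\<^sup>2))
                  + lambda_P * rho_sq"
    and "theta_u = min ((1 - rho_sq) / (64 * \<alpha>\<^sup>2 * v_hat))
                       (1 / (4 * \<alpha>\<^sup>2 * (L + 2 * lambda_P)))"
    and "theta_phi = \<phi> * theta_u"
    and "t_hat = sqrt ((rho_sq + 32 * \<alpha>\<^sup>2 * v_hat * theta_phi)\<^sup>2
                        + 128 * \<alpha>\<^sup>2 * v_hat * theta_phi)"
    and "rho_hat = 1 / 2 * (rho_sq + 32 * \<alpha>\<^sup>2 * v_hat * theta_phi) + 1 / 2 * t_hat"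
    and "star \<longleftrightarrow> ln (1 / \<zeta>) \<le> 128 * \<alpha> ^ 4 * v_hat * (L + 2 * lambda_P)
            * (theta_phi / (2 - rho_sq - t_hat - 32 * \<alpha>\<^sup>2 * v_hat * theta_phi))\<^sup>2"
  shows "(star \<longrightarrow> (\<forall>k.
            EVaR M \<sigma> \<zeta> (\<lambda>\<omega>. f (x k \<omega>) - f xs)
            \<le> ereal (\<sigma>\<^sup>2 * \<alpha>\<^sup>2 / (2 - rho_sq - t_hat)
                        * (sqrt (8 * (L + 2 * lambda_P)) + sqrt (64 * v_hat * ln (1 / \<zeta>)))\<^sup>2
                      + rho_hat ^ k * (2 * lyapunov f xs (gmm_P \<mu> vartheta \<alpha>) x0 xm))))
       \<and> (\<not> star \<longrightarrow> (\<forall>k.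
            EVaR M \<sigma> \<zeta> (\<lambda>\<omega>. f (x k \<omega>) - f xs)
            \<le> ereal (8 * \<sigma>\<^sup>2 * \<alpha>\<^sup>2 * (L + 2 * lambda_P)
                        / (2 - rho_sq - t_hat - 32 * \<alpha>\<^sup>2 * v_hat * theta_phi)
                      + 2 * \<sigma>\<^sup>2 / theta_phi * ln (1 / \<zeta>)
                      + rho_hat ^ k * (2 * lyapunov f xs (gmm_P \<mu> vartheta \<alpha>) x0 xm))))
       \<and> limsup (\<lambda>k. EVaR M \<sigma> \<zeta> (\<lambda>\<omega>. f (x k \<omega>) - f xs))
            \<le> ereal (if star
                then \<sigma>\<^sup>2 * \<alpha>\<^sup>2 / (2 - rho_sq - t_hat)
                       * (sqrt (8 * (L + 2 * lambda_P)) + sqrt (64 * v_hat * ln (1 / \<zeta>)))\<^sup>2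
                else 8 * \<sigma>\<^sup>2 * \<alpha>\<^sup>2 * (L + 2 * lambda_P)
                        / (2 - rho_sq - t_hat - 32 * \<alpha>\<^sup>2 * v_hat * theta_phi)
                      + 2 * \<sigma>\<^sup>2 / theta_phi * ln (1 / \<zeta>))"
proof -
  interpret prob_space M
    by (rule assms(11))
  interpret gmm_parameters \<mu> L vartheta \<psi> \<alpha> \<beta> \<gamma>
    by (rule admissible_gmm_parameters[OF assms(1,2,6,7,8,9,10)])
  define V0 where "V0 = V f xs x0 xm"
  define l where "l = ln (1 / \<zeta>)"
  define a where "a = 8 * \<alpha>\<^sup>2 * (L + 2 * lambda_P)"
  define b where "b = 32 * \<alpha>\<^sup>2 * v_hat"
  define D where "D = 2 - rho_sq - t_hat"
  define A where "A t = rho_sq + b * t" for t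
  have min: "f xs \<le> f y" for y
    using assms(5) by (cases "y = xs") auto
  have L: "0 < L"
    using mu_pos mu_less_L by simp
  have rho: "rho_sq = 1 - r"
    using assms(19) by (simp only: r_def)
  have rho_bounds: "0 < rho_sq" "rho_sq < 1"
    using r_pos r_less_1 by (simp_all add: rho)
  have lP: "0 < lambda_P"
    using assms(20) theta_pos alpha_pos by simp
  have v_ge: "lambda_P * rho_sq \<le> v_hat"
  proof -
    have "1 + 2 * \<gamma> + 2 * \<gamma>\<^sup>2 = (1 + \<gamma>)\<^sup>2 + \<gamma>\<^sup>2"
      by (simp add: power2_eq_square algebra_simps)
    then have "0 \<le> 1 + 2 * \<gamma> + 2 * \<gamma>\<^sup>2"
      by (simp only:) simp
    then have "0 \<le> 2 * L\<^sup>2 / \<mu> * (2 * (\<beta> - \<gamma>)\<^sup>2 + (1 - \<alpha> * L)\<^sup>2 * (1 + 2 * \<gamma> + 2 * \<gamma>\<^sup>2))"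
      using mu_pos by simp
    then show ?thesis
      unfolding assms(21) by simp
  qed
  then have v: "0 < v_hat"
    using mult_pos_pos[OF lP rho_bounds(1)] by linarith
  have pos: "0 < a" "0 < b" "0 < l"
    using alpha_pos L lP v assms(17,18) by (simp_all add: a_def b_def l_def)
  have theta_u: "0 < theta_u" "theta_u \<le> (1 - rho_sq) / (64 * \<alpha>\<^sup>2 * v_hat)"
      "theta_u \<le> 1 / (4 * \<alpha>\<^sup>2 * (L + 2 * lambda_P))"
    unfolding assms(22) using rho_bounds alpha_pos v L lP by simp_all
  have T: "0 < theta_phi" "theta_phi < theta_u"
    using theta_u assms(15,16) by (simp_all add: assms(23))
  have bT: "2 * (b * theta_phi) < 1 - rho_sq"
  proof -
    have "2 * (b * theta_phi) < 2 * b * theta_u"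
      using T pos by simp
    also have "\<dots> \<le> 2 * b * ((1 - rho_sq) / (64 * \<alpha>\<^sup>2 * v_hat))"
      using theta_u(2) pos by (intro mult_left_mono) simp_all
    also have "\<dots> = 1 - rho_sq"
      using alpha_pos v by (simp add: b_def)
    finally show ?thesis .
  qed
  \<comment> \<open>\<open>rho_hat\<close> is the larger root of \<open>z\<^sup>2 = A z + B\<close> with \<open>A = A theta_phi\<close>, \<open>B = b theta_phi\<close>: it is at least \<open>A\<close>, and less than \<open>1\<close> because \<open>A + B < 1\<close>.\<close>
  have t_hat: "t_hat = sqrt ((A theta_phi)\<^sup>2 + 4 * (b * theta_phi))"
    by (simp add: assms(24) A_def b_def)
  have rho_hat: "rho_hat = (A theta_phi + t_hat) / 2"
    by (simp add: assms(25) A_def b_def)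
  have bT_pos: "0 < b * theta_phi"
    using pos T by simp
  have A_T: "0 < A theta_phi" "A theta_phi < 1"
    using bT bT_pos rho_bounds by (simp_all add: A_def)
  have t_hat_ge: "A theta_phi \<le> t_hat"
    unfolding t_hat using bT_pos by (intro real_le_rsqrt) simp
  have t_hat_less: "t_hat < 2 - A theta_phi"
    unfolding t_hat
  proof (rule real_less_lsqrt)
    have "(A theta_phi)\<^sup>2 + 4 * (b * theta_phi) < (A theta_phi)\<^sup>2 + 4 * (1 - A theta_phi)"
      using bT by (simp add: A_def)
    also have "\<dots> = (2 - A theta_phi)\<^sup>2"
      by (simp add: power2_eq_square algebra_simps)
    finally show "(A theta_phi)\<^sup>2 + 4 * (b * theta_phi) < (2 - A theta_phi)\<^sup>2" .
  qed (use A_T in simp)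
  have rho_hat_bounds: "0 \<le> rho_hat" "rho_hat < 1" "A theta_phi \<le> rho_hat"
    using A_T t_hat_ge t_hat_less by (simp_all add: rho_hat)
  have DT: "b * theta_phi < D"
    using t_hat_less by (simp add: D_def A_def)
  have V0: "0 \<le> V0"
    using lyapunov_ge_gap[of f x0 xs xm] min[of x0] by (simp add: V0_def)
  have risk: "EVaR M \<sigma> \<zeta> (\<lambda>\<omega>. f (x k \<omega>) - f xs)
      \<le> ereal (\<sigma>\<^sup>2 * (a / (D - b * t) + 2 * l / t) + rho_hat ^ k * (2 * V0))"
    if t: "0 < t" "t \<le> theta_phi" for t k
  proof -
    define n where "n = 4 * \<sigma>\<^sup>2 * \<alpha>\<^sup>2 * (L + 2 * lambda_P)"
    have bt: "b * t \<le> b * theta_phi"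
      using t pos by simp
    have A_t: "0 \<le> A t" "A t \<le> A theta_phi"
      using bt t pos rho_bounds by (simp_all add: A_def)
    have t_small: "4 * \<alpha>\<^sup>2 * (L + 2 * lambda_P) * t \<le> 1"
    proof -
      have "4 * \<alpha>\<^sup>2 * (L + 2 * lambda_P) * t \<le> 4 * \<alpha>\<^sup>2 * (L + 2 * lambda_P) * (1 / (4 * \<alpha>\<^sup>2 * (L + 2 * lambda_P)))"
        using t T theta_u(3) L lP by (intro mult_left_mono) simp_all
      also have "\<dots> = 1"
        using alpha_pos L lP by simp
      finally show ?thesis .
    qed
    have A_eq: "A t = (1 - r) + 32 * \<alpha>\<^sup>2 * v_hat * t"
      by (simp add: A_def b_def rho)
    have c: "0 \<le> t / (2 * \<sigma>\<^sup>2)" "2 * \<sigma>\<^sup>2 * (t / (2 * \<sigma>\<^sup>2)) \<le> t"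
      using t assms(12) by simp_all
    have "A t < 1"
      using A_t A_T by simp
    note moment = lyapunov_exp_moment[OF assms(11,13,14,12,3,4) min
        v_ge[unfolded assms(20) rho] less_imp_le[OF t(1)] t_small[unfolded assms(20)]
        A_eq \<open>A t < 1\<close> n_def[unfolded assms(20)] c, of k]
    have "continuous_on UNIV f"
      using assms(4) by (auto simp: smooth_def intro!: continuous_at_imp_continuous_on
          differentiable_imp_continuous_within)
    then have gap_meas: "(\<lambda>\<omega>. f (x k \<omega>) - f xs) \<in> borel_measurable M"
      by (intro borel_measurable_continuous_on[OF _ moment(1)] continuous_intros)
    have "entropic_risk M \<sigma> (\<lambda>\<omega>. f (x k \<omega>) - f xs) t
        \<le> ereal (n / (1 - A t) + A t ^ k * V f xs x0 xm)"
      by (rule entropic_risk_le[OF gap_meas _ t(1) assms(12) moment(2)]) (use min in simp)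
    then have "EVaR M \<sigma> \<zeta> (\<lambda>\<omega>. f (x k \<omega>) - f xs)
        \<le> ereal (n / (1 - A t) + A t ^ k * V f xs x0 xm + 2 * \<sigma>\<^sup>2 / t * ln (1 / \<zeta>))"
      by (rule EVaR_le[OF t(1)])
    also have "\<dots> \<le> ereal (\<sigma>\<^sup>2 * (a / (D - b * t) + 2 * l / t) + rho_hat ^ k * (2 * V0))"
    proof -
      have "n / (1 - A t) = 2 * n / (2 * (1 - A t))"
        by (rule mult_divide_mult_cancel_left[symmetric]) simp
      also have "\<dots> \<le> 2 * n / (D - b * t)"
      proof (rule divide_left_mono)
        \<comment> \<open>Equivalent to \<open>A t \<le> t_hat\<close>.\<close>
        show "D - b * t \<le> 2 * (1 - A t)"
          using t_hat_ge bt by (simp add: D_def A_def)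
        show "0 \<le> 2 * n"
          using L lP by (simp add: n_def)
        show "0 < 2 * (1 - A t) * (D - b * t)"
          using \<open>A t < 1\<close> DT bt by (intro mult_pos_pos) simp_all
      qed
      also have "\<dots> = \<sigma>\<^sup>2 * (a / (D - b * t))"
        by (simp add: n_def a_def)
      finally have one: "n / (1 - A t) \<le> \<sigma>\<^sup>2 * (a / (D - b * t))" .
      have "A t ^ k * V0 \<le> rho_hat ^ k * V0"
        using A_t rho_hat_bounds V0 by (intro mult_right_mono power_mono) simp_all
      also have "\<dots> \<le> rho_hat ^ k * (2 * V0)"
        using rho_hat_bounds V0 by (intro mult_left_mono) simp_all
      finally show ?thesis
        using one by (simp add: V0_def[symmetric] l_def[symmetric] algebra_simps)
    qed
    finally show ?thesis .
  qed
  define C where "C = (if star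
      then \<sigma>\<^sup>2 * \<alpha>\<^sup>2 / (2 - rho_sq - t_hat)
        * (sqrt (8 * (L + 2 * lambda_P)) + sqrt (64 * v_hat * ln (1 / \<zeta>)))\<^sup>2
      else 8 * \<sigma>\<^sup>2 * \<alpha>\<^sup>2 * (L + 2 * lambda_P) / (2 - rho_sq - t_hat - 32 * \<alpha>\<^sup>2 * v_hat * theta_phi)
        + 2 * \<sigma>\<^sup>2 / theta_phi * ln (1 / \<zeta>))"
  obtain t where t: "0 < t" "t \<le> theta_phi" "\<sigma>\<^sup>2 * (a / (D - b * t) + 2 * l / t) = C"
  proof (cases star)
    case True
    have "2 * l * (D - b * theta_phi)\<^sup>2 \<le> a * b * theta_phi\<^sup>2"
    proof -
      have "l \<le> 128 * \<alpha> ^ 4 * v_hat * (L + 2 * lambda_P) * (theta_phi / (D - b * theta_phi))\<^sup>2"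
        using True assms(26) by (simp add: l_def D_def b_def)
      also have "\<dots> = a * b / 2 * theta_phi\<^sup>2 / (D - b * theta_phi)\<^sup>2"
        by (simp add: a_def b_def power_divide eval_nat_numeral)
      finally show ?thesis
        using DT by (simp add: pos_le_divide_eq)
    qed
    moreover have "0 < D"
      using DT bT_pos by linarith
    ultimately obtain t where t: "0 < t" "t \<le> theta_phi"
        "a / (D - b * t) + 2 * l / t = (sqrt a + sqrt (2 * l * b))\<^sup>2 / D"
      using risk_bound_minimiser[of a b D l theta_phi] pos T DT by metis
    have sqrt_scale: "sqrt (\<alpha>\<^sup>2 * y) = \<alpha> * sqrt y" for y
      using alpha_pos by (simp add: real_sqrt_mult)
    have "sqrt a = \<alpha> * sqrt (8 * (L + 2 * lambda_P))"
      using sqrt_scale[of "8 * (L + 2 * lambda_P)"] by (simp only: a_def mult_ac)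
    moreover have "2 * l * b = \<alpha>\<^sup>2 * (64 * v_hat * l)"
      by (simp add: b_def)
    then have "sqrt (2 * l * b) = \<alpha> * sqrt (64 * v_hat * l)"
      by (simp only: sqrt_scale)
    ultimately have "\<sigma>\<^sup>2 * ((sqrt a + sqrt (2 * l * b))\<^sup>2 / D) = C"
      using True by (simp add: C_def D_def l_def power_mult_distrib flip: distrib_left)
    then have "\<sigma>\<^sup>2 * (a / (D - b * t) + 2 * l / t) = C"
      by (simp only: t(3))
    with t(1,2) show thesis
      by (rule that)
  next
    case False
    have "\<sigma>\<^sup>2 * (a / (D - b * theta_phi) + 2 * l / theta_phi) = C"
      using False by (simp add: C_def D_def a_def b_def l_def algebra_simps)
    with T show thesis
      by (intro that) simp_all
  qed
  have bound: "EVaR M \<sigma> \<zeta> (\<lambda>\<omega>. f (x k \<omega>) - f xs) \<le> ereal (C + rho_hat ^ k * (2 * V0))" for k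
    using risk[OF t(1,2), of k] unfolding t(3) .
  have "(\<lambda>k. C + rho_hat ^ k * (2 * V0)) \<longlonglongrightarrow> C + 0 * (2 * V0)"
    using rho_hat_bounds by (intro tendsto_intros LIMSEQ_power_zero) simp
  then have "limsup (\<lambda>k. ereal (C + rho_hat ^ k * (2 * V0))) = ereal C"
    by (intro lim_imp_Limsup tendsto_ereal) simp_all
  moreover have "limsup (\<lambda>k. EVaR M \<sigma> \<zeta> (\<lambda>\<omega>. f (x k \<omega>) - f xs))
      \<le> limsup (\<lambda>k. ereal (C + rho_hat ^ k * (2 * V0)))"
    by (intro Limsup_mono always_eventually allI bound)
  ultimately have lim: "limsup (\<lambda>k. EVaR M \<sigma> \<zeta> (\<lambda>\<omega>. f (x k \<omega>) - f xs)) \<le> ereal C"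
    by simp
  show ?thesis
  proof (intro conjI impI allI)
    fix k
    assume star
    then show "EVaR M \<sigma> \<zeta> (\<lambda>\<omega>. f (x k \<omega>) - f xs)
        \<le> ereal (\<sigma>\<^sup>2 * \<alpha>\<^sup>2 / (2 - rho_sq - t_hat)
              * (sqrt (8 * (L + 2 * lambda_P)) + sqrt (64 * v_hat * ln (1 / \<zeta>)))\<^sup>2
            + rho_hat ^ k * (2 * V f xs x0 xm))"
      using bound[of k] unfolding C_def V0_def by (simp only: if_True)
  next
    fix k
    assume "\<not> star"
    then show "EVaR M \<sigma> \<zeta> (\<lambda>\<omega>. f (x k \<omega>) - f xs)
        \<le> ereal (8 * \<sigma>\<^sup>2 * \<alpha>\<^sup>2 * (L + 2 * lambda_P)
              / (2 - rho_sq - t_hat - 32 * \<alpha>\<^sup>2 * v_hat * theta_phi)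
            + 2 * \<sigma>\<^sup>2 / theta_phi * ln (1 / \<zeta>)
            + rho_hat ^ k * (2 * V f xs x0 xm))"
      using bound[of k] unfolding C_def V0_def by (simp only: if_False)
  qed (use lim[unfolded C_def] in simp)
qed

end
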